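(* Every cocomplete category $\mathsf{C}$ equipped with a choice of colimit for each diagram has the structure of a pseudoalgebra over the pseudomonad $\mathsf{Diag}$.
   Context: $\mathsf{CAT}$ is the 2-category of (possibly large) locally small categories. A cocomplete category is a (possibly large) locally small category admitting all small colimits. A diagram in $\mathsf{C}$ is always small: a small category $\mathsf{J}$ with a functor $D:\mathsf{J}\to\mathsf{C}$. The pseudomonad $\mathsf{Diag}$ on $\mathsf{CAT}$. For $\mathsf{C}$ locally small, $\mathsf{Diag}(\mathsf{C})$ is the category whose objects are diagrams $(\mathsf{J},D:\mathsf{J}\to\mathsf{C})$ and whose morphisms $(\mathsf{J},D)\to(\mathsf{J}',D')$ are pairs $(R:\mathsf{J}\to\mathsf{J}',\ \rho:D\Rightarrow D'\circ R)$. A functor $F:\mathsf{C}\to\mathsf{D}$ induces $F_*:\mathsf{Diag}(\mathsf{C})\to\mathsf{Diag}(\mathsf{D})$ by postcomposition and whiskering; a natural transformation $\alpha:F\Rightarrow G$ induces $\alpha_*$ with components $(\mathrm{id}_{\mathsf{J}},\alpha D)$. This is a strict 2-functor $\mathsf{CAT}\to\mathsf{CAT}$. Unit $\eta:\mathsf{C}\to\mathsf{Diag}(\mathsf{C})$: $C\mapsto(C:\mathsf{1}\to\mathsf{C})$, $f\mapsto(\mathrm{id}_{\mathsf 1},f)$. Multiplication $\mu:\mathsf{Diag}(\mathsf{Diag}(\mathsf{C}))\to\mathsf{Diag}(\mathsf{C})$: for $D:\mathsf{J}\to\mathsf{Diag}(\mathsf{C})$, write $D(J)=(D_0J,D_1J:D_0J\to\mathsf{C})$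 and $D(j)=(D_0j,\ D_1j:D_1J\Rightarrow D_1J'\circ D_0j)$; $\mu(D)$ is the diagram on the Grothendieck construction $\int D_0$ (objects $(J,X)$, $X\in D_0J$; morphisms $(j,f):(J,X)\to(J',X')$ with $f:D_0j(X)\to X'$) given by $(J,X)\mapsto D_1J(X)$, $(j,f)\mapsto D_1J'(f)\circ(D_1j)_X$. On a morphism $(F,\phi)$ with $\phi_J=(\phi_0J,\phi_1J)$, $\mu(F,\phi)$ is the functor $(J,X)\mapsto(FJ,\phi_0J(X))$, $(j,f:D_0j(X)\to X')\mapsto(Fj,\phi_0J'(f))$, with natural transformation of components $(\phi_1J)_X$. Both $\eta$ and $\mu$ are strictly natural. Unitors and associator: $\ell:\mu\circ\eta_{\mathsf{Diag}}\Rrightarrow\mathrm{id}$, $r:\mathrm{id}\Rrightarrow\mu\circ\eta_*$, $a:\mu\circ\mu_*\Rrightarrow\mu\circ\mu_{\mathsf{Diag}}$ are the isomorphisms of diagrams given on indexing categories by $(\bullet,X)\mapsto X$, $X\mapsto(X,\bullet)$, $(J,(K,L))\mapsto((J,K),L)$, where $\bullet$ is the object of $\mathsf{1}$. Pseudoalgebra over $\mathsf{Diag}$: an object $\mathsf{A}$ of $\mathsf{CAT}$, a functor $e:\mathsf{Diag}(\mathsf{A})\to\mathsf{A}$ and natural isomorphisms $\iota:e\circ\eta_{\mathsf{A}}\Rightarrow\mathrm{id}_{\mathsf{A}}$, $\gamma:e\circ e_*\Rightarrow e\circ\mu_{\mathsf{A}}$ such that (whiskerings by juxtaposition) $\gamma\,\eta_*=(e\,r_{\mathsf{A}})\circ(e\,\iota_*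 )$ as natural transformations $e\circ e_*\circ\eta_*\Rightarrow e\circ\mu_{\mathsf{A}}\circ\eta_*$, and $(e\,a_{\mathsf{A}})\circ(\gamma\,\mu_* )\circ(e\,\gamma_* )=(\gamma\,\mu_{\mathsf{Diag}(\mathsf{A})})\circ(\gamma\,e_{**})$ as natural transformations $e\circ e_*\circ e_{**}\Rightarrow e\circ\mu_{\mathsf{A}}\circ\mu_{\mathsf{Diag}(\mathsf{A})}$ (using $\mu_{\mathsf{A}}\circ e_{**}=e_*\circ\mu_{\mathsf{Diag}(\mathsf{A})}$). *)

theory Defs
  imports Main "HOL-Library.FuncSet" "HOL-Library.Equipollence"
begin

section \<open>Size: a universe of small sets\<close>

text \<open>
  A type of class \<open>universe\<close> plays the role of a Grothendieck universe: its elements are the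
  small sets, and \<open>elts x\<close> is the set of members of \<open>x\<close>. Foundation and infinity are not
  assumed; universes having them are instances. Large categories live on arbitrary types.
\<close>

class universe =
  fixes elts :: "'a \<Rightarrow> 'a set"
  assumes elts_ext: "inj elts"
    and elts_subset: "Y \<subseteq> elts x \<Longrightarrow> \<exists>y. elts y = Y"
    and elts_Union: "\<exists>y. elts y = (\<Union>z\<in>elts x. elts z)"
    and elts_Pow: "\<exists>y. elts y = {z. elts z \<subseteq> elts x}"
    and elts_replacement: "\<exists>y. elts y = f ` elts x"

definition small :: "'u::universe set \<Rightarrow> bool"
  where "small A \<longleftrightarrow> A \<in> range elts"

definition vset :: "'u::universe set \<Rightarrow> 'u"
  where "vset A = inv elts A"

text \<open>Kuratowski pairs inside the universe.\<close>

definition vpair :: "'u::universe \<Rightarrow> 'u \<Rightarrow> 'u"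
  where "vpair a b = vset {vset {a}, vset {a, b}}"

definition vfst :: "'u::universe \<Rightarrow> 'u"
  where "vfst p = (THE a. \<exists>b. p = vpair a b)"

definition vsnd :: "'u::universe \<Rightarrow> 'u"
  where "vsnd p = (THE b. \<exists>a. p = vpair a b)"

section \<open>Categories, functors, natural transformations\<close>

text \<open>
  All structure maps are extensional (\<open>undefined\<close> off their domain), so that HOL equality of
  categories, functors and natural transformations is mathematical equality.
  \<open>cmp C g f\<close> is the composite of \<open>g\<close> after \<open>f\<close>.
\<close>

record ('o, 'a) cat =
  obj :: "'o set"
  arr :: "'a set"
  src :: "'a \<Rightarrow> 'o"
  tgt :: "'a \<Rightarrow> 'o"
  idn :: "'o \<Rightarrow> 'a"
  cmp :: "'a \<Rightarrow> 'a \<Rightarrow> 'a"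

definition hom :: "('o, 'a) cat \<Rightarrow> 'o \<Rightarrow> 'o \<Rightarrow> 'a set"
  where "hom C x y = {f \<in> arr C. src C f = x \<and> tgt C f = y}"

definition category :: "('o, 'a) cat \<Rightarrow> bool"
  where "category C \<longleftrightarrow>
    src C \<in> arr C \<rightarrow>\<^sub>E obj C \<and> tgt C \<in> arr C \<rightarrow>\<^sub>E obj C \<and> idn C \<in> obj C \<rightarrow>\<^sub>E arr C \<and>
    (\<forall>x\<in>obj C. idn C x \<in> hom C x x) \<and>
    (\<forall>g f. \<not> (g \<in> arr C \<and> f \<in> arr C \<and> src C g = tgt C f) \<longrightarrow> cmp C g f = undefined) \<and>
    (\<forall>x\<in>obj C. \<forall>y\<in>obj C. \<forall>z\<in>obj C. \<forall>f\<in>hom C x y. \<forall>g\<in>hom C y z. cmp C g f \<in> hom C x z) \<and>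
    (\<forall>f\<in>arr C. cmp C f (idn C (src C f)) = f \<and> cmp C (idn C (tgt C f)) f = f) \<and>
    (\<forall>f\<in>arr C. \<forall>g\<in>arr C. \<forall>h\<in>arr C. src C g = tgt C f \<longrightarrow> src C h = tgt C g \<longrightarrow>
       cmp C h (cmp C g f) = cmp C (cmp C h g) f)"

record ('o, 'a, 'p, 'b) ftor =
  fob :: "'o \<Rightarrow> 'p"
  far :: "'a \<Rightarrow> 'b"

definition is_functor :: "('o, 'a) cat \<Rightarrow> ('p, 'b) cat \<Rightarrow> ('o, 'a, 'p, 'b) ftor \<Rightarrow> bool"
  where "is_functor C D F \<longleftrightarrow> category C \<and> category D \<and>
    fob F \<in> obj C \<rightarrow>\<^sub>E obj D \<and> far F \<in> arr C \<rightarrow>\<^sub>E arr D \<and>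
    (\<forall>f\<in>arr C. far F f \<in> hom D (fob F (src C f)) (fob F (tgt C f))) \<and>
    (\<forall>x\<in>obj C. far F (idn C x) = idn D (fob F x)) \<and>
    (\<forall>f\<in>arr C. \<forall>g\<in>arr C. src C g = tgt C f \<longrightarrow>
       far F (cmp C g f) = cmp D (far F g) (far F f))"

definition id_functor :: "('o, 'a) cat \<Rightarrow> ('o, 'a, 'o, 'a) ftor"
  where "id_functor C = \<lparr>fob = (\<lambda>x\<in>obj C. x), far = (\<lambda>f\<in>arr C. f)\<rparr>"

text \<open>In \<open>comp_functor C G F\<close> (\<open>G\<close> after \<open>F\<close>) and the whiskerings below, \<open>C\<close> is the domain of the result.\<close>

definition comp_functor :: "('o, 'a) cat \<Rightarrow> ('p, 'b, 'q, 'c) ftor \<Rightarrow> ('o, 'a, 'p, 'b) ftor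
    \<Rightarrow> ('o, 'a, 'q, 'c) ftor"
  where "comp_functor C G F = \<lparr>fob = compose (obj C) (fob G) (fob F),
                        far = compose (arr C) (far G) (far F)\<rparr>"

definition const_functor :: "('o, 'a) cat \<Rightarrow> ('p, 'b) cat \<Rightarrow> 'p \<Rightarrow> ('o, 'a, 'p, 'b) ftor"
  where "const_functor C D y = \<lparr>fob = (\<lambda>x\<in>obj C. y), far = (\<lambda>f\<in>arr C. idn D y)\<rparr>"

definition is_nat :: "('o, 'a) cat \<Rightarrow> ('p, 'b) cat \<Rightarrow> ('o, 'a, 'p, 'b) ftor \<Rightarrow>
    ('o, 'a, 'p, 'b) ftor \<Rightarrow> ('o \<Rightarrow> 'b) \<Rightarrow> bool"
  where "is_nat C D F G \<alpha> \<longleftrightarrow> is_functor C D F \<and> is_functor C D G \<and>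
    \<alpha> \<in> obj C \<rightarrow>\<^sub>E arr D \<and>
    (\<forall>x\<in>obj C. \<alpha> x \<in> hom D (fob F x) (fob G x)) \<and>
    (\<forall>f\<in>arr C. cmp D (\<alpha> (tgt C f)) (far F f) = cmp D (far G f) (\<alpha> (src C f)))"

definition is_iso :: "('o, 'a) cat \<Rightarrow> 'a \<Rightarrow> bool"
  where "is_iso C f \<longleftrightarrow> f \<in> arr C \<and> (\<exists>g\<in>hom C (tgt C f) (src C f).
    cmp C g f = idn C (src C f) \<and> cmp C f g = idn C (tgt C f))"

definition is_nat_iso :: "('o, 'a) cat \<Rightarrow> ('p, 'b) cat \<Rightarrow> ('o, 'a, 'p, 'b) ftor \<Rightarrow>
    ('o, 'a, 'p, 'b) ftor \<Rightarrow> ('o \<Rightarrow> 'b) \<Rightarrow> bool"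
  where "is_nat_iso C D F G \<alpha> \<longleftrightarrow> is_nat C D F G \<alpha> \<and> (\<forall>x\<in>obj C. is_iso D (\<alpha> x))"

definition vcomp :: "('o, 'a) cat \<Rightarrow> ('p, 'b) cat \<Rightarrow> ('o \<Rightarrow> 'b) \<Rightarrow> ('o \<Rightarrow> 'b) \<Rightarrow> ('o \<Rightarrow> 'b)"
  where "vcomp C D \<beta> \<alpha> = (\<lambda>x\<in>obj C. cmp D (\<beta> x) (\<alpha> x))"

definition whisker_left :: "('o, 'a) cat \<Rightarrow> ('p, 'b, 'q, 'c) ftor \<Rightarrow> ('o \<Rightarrow> 'b) \<Rightarrow> ('o \<Rightarrow> 'c)"
  where "whisker_left C G \<alpha> = compose (obj C) (far G) \<alpha>"

definition whisker_right :: "('o, 'a) cat \<Rightarrow> ('p \<Rightarrow> 'c) \<Rightarrow> ('o, 'a, 'p, 'b) ftor \<Rightarrow> ('o \<Rightarrow> 'c)"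
  where "whisker_right C \<alpha> F = compose (obj C) \<alpha> (fob F)"

text \<open>A small category has its objects and arrows in the universe, forming small sets of it.\<close>

definition small_category :: "('u::universe, 'u) cat \<Rightarrow> bool"
  where "small_category J \<longleftrightarrow> category J \<and> small (obj J) \<and> small (arr J)"

definition locally_small :: "'u::universe itself \<Rightarrow> ('o, 'a) cat \<Rightarrow> bool"
  where "locally_small U C \<longleftrightarrow>
    (\<forall>x\<in>obj C. \<forall>y\<in>obj C. \<exists>S :: 'u set. small S \<and> hom C x y \<approx> S)"

section \<open>The category of diagrams\<close>

record ('u, 'o, 'a) dgm =
  shape :: "('u, 'u) cat"
  dfun :: "('u, 'u, 'o, 'a) ftor"

record ('u, 'o, 'a) dmor =
  msrc :: "('u, 'o, 'a) dgm"
  mtgt :: "('u, 'o, 'a) dgm"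
  mfun :: "('u, 'u, 'u, 'u) ftor"
  mnat :: "'u \<Rightarrow> 'a"

definition is_dgm :: "('o, 'a) cat \<Rightarrow> ('u::universe, 'o, 'a) dgm \<Rightarrow> bool"
  where "is_dgm C D \<longleftrightarrow> small_category (shape D) \<and> is_functor (shape D) C (dfun D)"

definition is_dmor :: "('o, 'a) cat \<Rightarrow> ('u::universe, 'o, 'a) dmor \<Rightarrow> bool"
  where "is_dmor C m \<longleftrightarrow> is_dgm C (msrc m) \<and> is_dgm C (mtgt m) \<and>
    is_functor (shape (msrc m)) (shape (mtgt m)) (mfun m) \<and>
    is_nat (shape (msrc m)) C (dfun (msrc m))
      (comp_functor (shape (msrc m)) (dfun (mtgt m)) (mfun m)) (mnat m)"

definition Diag :: "('o, 'a) cat \<Rightarrow> (('u::universe, 'o, 'a) dgm, ('u, 'o, 'a) dmor) cat"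
  where "Diag C = \<lparr>
    obj = {D. is_dgm C D},
    arr = {m. is_dmor C m},
    src = (\<lambda>m\<in>{m. is_dmor C m}. msrc m),
    tgt = (\<lambda>m\<in>{m. is_dmor C m}. mtgt m),
    idn = (\<lambda>D\<in>{D. is_dgm C D}. \<lparr>msrc = D, mtgt = D, mfun = id_functor (shape D),
             mnat = (\<lambda>x\<in>obj (shape D). idn C (fob (dfun D) x))\<rparr>),
    cmp = (\<lambda>n m. if is_dmor C n \<and> is_dmor C m \<and> msrc n = mtgt m
             then \<lparr>msrc = msrc m, mtgt = mtgt n,
                   mfun = comp_functor (shape (msrc m)) (mfun n) (mfun m),
                   mnat = vcomp (shape (msrc m)) C
                     (whisker_right (shape (msrc m)) (mnat n) (mfun m)) (mnat m)\<rparr>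
             else undefined)\<rparr>"

text \<open>The action of \<open>Diag\<close> on a functor \<open>F\<close> with domain \<open>C\<close>, and on \<open>\<alpha>\<close> from \<open>F\<close> to \<open>G\<close>.\<close>

definition push_dgm :: "('o, 'a, 'p, 'b) ftor \<Rightarrow> ('u, 'o, 'a) dgm \<Rightarrow> ('u, 'p, 'b) dgm"
  where "push_dgm F D = \<lparr>shape = shape D, dfun = comp_functor (shape D) F (dfun D)\<rparr>"

definition star :: "('o, 'a) cat \<Rightarrow> ('o, 'a, 'p, 'b) ftor \<Rightarrow>
    (('u::universe, 'o, 'a) dgm, ('u, 'o, 'a) dmor, ('u, 'p, 'b) dgm, ('u, 'p, 'b) dmor) ftor"
  where "star C F = \<lparr>
    fob = (\<lambda>D\<in>obj (Diag C). push_dgm F D),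
    far = (\<lambda>m\<in>arr (Diag C). \<lparr>msrc = push_dgm F (msrc m), mtgt = push_dgm F (mtgt m),
             mfun = mfun m, mnat = whisker_left (shape (msrc m)) F (mnat m)\<rparr>)\<rparr>"

definition nat_star :: "('o, 'a) cat \<Rightarrow> ('o, 'a, 'p, 'b) ftor \<Rightarrow> ('o, 'a, 'p, 'b) ftor \<Rightarrow>
    ('o \<Rightarrow> 'b) \<Rightarrow> ('u::universe, 'o, 'a) dgm \<Rightarrow> ('u, 'p, 'b) dmor"
  where "nat_star C F G \<alpha> = (\<lambda>D\<in>obj (Diag C). \<lparr>msrc = push_dgm F D, mtgt = push_dgm G D,
    mfun = id_functor (shape D), mnat = whisker_right (shape D) \<alpha> (dfun D)\<rparr>)"

section \<open>Unit\<close>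

definition pt :: "'u::universe"
  where "pt = vset {}"

definition one :: "('u::universe, 'u) cat"
  where "one = \<lparr>obj = {pt}, arr = {pt}, src = (\<lambda>f\<in>{pt}. pt), tgt = (\<lambda>f\<in>{pt}. pt),
    idn = (\<lambda>x\<in>{pt}. pt), cmp = (\<lambda>g f. if g = pt \<and> f = pt then pt else undefined)\<rparr>"

definition point_dgm :: "('o, 'a) cat \<Rightarrow> 'o \<Rightarrow> ('u::universe, 'o, 'a) dgm"
  where "point_dgm C x = \<lparr>shape = one, dfun = const_functor one C x\<rparr>"

definition eta :: "('o, 'a) cat \<Rightarrow> ('o, 'a, ('u::universe, 'o, 'a) dgm, ('u, 'o, 'a) dmor) ftor"
  where "eta C = \<lparr>
    fob = (\<lambda>x\<in>obj C. point_dgm C x),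
    far = (\<lambda>f\<in>arr C. \<lparr>msrc = point_dgm C (src C f), mtgt = point_dgm C (tgt C f),
             mfun = id_functor one, mnat = (\<lambda>x\<in>{pt}. f)\<rparr>)\<rparr>"

section \<open>Multiplication\<close>

text \<open>
  The Grothendieck construction of \<open>J\<close>-indexed categories \<open>K\<close> with transition functors \<open>T\<close>.
  An arrow \<open>(j, f)\<close> out of \<open>(J, X)\<close> is coded as \<open>garr X j f\<close>; the point \<open>X\<close> is recorded because
  \<open>(j, f)\<close> alone does not determine the source.
\<close>

definition garr :: "'u::universe \<Rightarrow> 'u \<Rightarrow> 'u \<Rightarrow> 'u"
  where "garr X j f = vpair X (vpair j f)"

definition gpt :: "'u::universe \<Rightarrow> 'u"
  where "gpt a = vfst a"

definition gbase :: "'u::universe \<Rightarrow> 'u"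
  where "gbase a = vfst (vsnd a)"

definition gfib :: "'u::universe \<Rightarrow> 'u"
  where "gfib a = vsnd (vsnd a)"

definition groth_obj :: "('u::universe, 'u) cat \<Rightarrow> ('u \<Rightarrow> ('u, 'u) cat) \<Rightarrow> 'u set"
  where "groth_obj J K = {vpair x X | x X. x \<in> obj J \<and> X \<in> obj (K x)}"

definition groth_arr :: "('u::universe, 'u) cat \<Rightarrow> ('u \<Rightarrow> ('u, 'u) cat) \<Rightarrow>
    ('u \<Rightarrow> ('u, 'u, 'u, 'u) ftor) \<Rightarrow> 'u set"
  where "groth_arr J K T = {garr X j f | X j f. j \<in> arr J \<and> X \<in> obj (K (src J j)) \<and>
    f \<in> arr (K (tgt J j)) \<and> src (K (tgt J j)) f = fob (T j) X}"

definition groth_src :: "('u::universe, 'u) cat \<Rightarrow> 'u \<Rightarrow> 'u"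
  where "groth_src J a = vpair (src J (gbase a)) (gpt a)"

definition groth_tgt :: "('u::universe, 'u) cat \<Rightarrow> ('u \<Rightarrow> ('u, 'u) cat) \<Rightarrow> 'u \<Rightarrow> 'u"
  where "groth_tgt J K a = vpair (tgt J (gbase a)) (tgt (K (tgt J (gbase a))) (gfib a))"

definition groth :: "('u::universe, 'u) cat \<Rightarrow> ('u \<Rightarrow> ('u, 'u) cat) \<Rightarrow>
    ('u \<Rightarrow> ('u, 'u, 'u, 'u) ftor) \<Rightarrow> ('u, 'u) cat"
  where "groth J K T = \<lparr>
    obj = groth_obj J K,
    arr = groth_arr J K T,
    src = (\<lambda>a\<in>groth_arr J K T. groth_src J a),
    tgt = (\<lambda>a\<in>groth_arr J K T. groth_tgt J K a),
    idn = (\<lambda>p\<in>groth_obj J K.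
             garr (vsnd p) (idn J (vfst p)) (idn (K (vfst p)) (vsnd p))),
    cmp = (\<lambda>b a. if b \<in> groth_arr J K T \<and> a \<in> groth_arr J K T \<and> groth_src J b = groth_tgt J K a
             then garr (gpt a) (cmp J (gbase b) (gbase a))
                    (cmp (K (tgt J (gbase b))) (gfib b) (far (T (gbase b)) (gfib a)))
             else undefined)\<rparr>"

definition mu_shape :: "('u::universe, ('u, 'o, 'a) dgm, ('u, 'o, 'a) dmor) dgm \<Rightarrow> ('u, 'u) cat"
  where "mu_shape D =
    groth (shape D) (\<lambda>j. shape (fob (dfun D) j)) (\<lambda>j. mfun (far (dfun D) j))"

definition mu_dgm :: "('o, 'a) cat \<Rightarrow> ('u::universe, ('u, 'o, 'a) dgm, ('u, 'o, 'a) dmor) dgm \<Rightarrow>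
    ('u, 'o, 'a) dgm"
  where "mu_dgm C D = \<lparr>
    shape = mu_shape D,
    dfun = \<lparr>
      fob = (\<lambda>p\<in>obj (mu_shape D). fob (dfun (fob (dfun D) (vfst p))) (vsnd p)),
      far = (\<lambda>a\<in>arr (mu_shape D).
               cmp C (far (dfun (fob (dfun D) (tgt (shape D) (gbase a)))) (gfib a))
                     (mnat (far (dfun D) (gbase a)) (gpt a)))\<rparr>\<rparr>"

definition mu_dmor :: "('o, 'a) cat \<Rightarrow> ('u::universe, ('u, 'o, 'a) dgm, ('u, 'o, 'a) dmor) dmor \<Rightarrow>
    ('u, 'o, 'a) dmor"
  where "mu_dmor C m = \<lparr>
    msrc = mu_dgm C (msrc m),
    mtgt = mu_dgm C (mtgt m),
    mfun = \<lparr>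
      fob = (\<lambda>p\<in>obj (mu_shape (msrc m)).
               vpair (fob (mfun m) (vfst p)) (fob (mfun (mnat m (vfst p))) (vsnd p))),
      far = (\<lambda>a\<in>arr (mu_shape (msrc m)).
               garr (fob (mfun (mnat m (src (shape (msrc m)) (gbase a)))) (gpt a))
                    (far (mfun m) (gbase a))
                    (far (mfun (mnat m (tgt (shape (msrc m)) (gbase a)))) (gfib a)))\<rparr>,
    mnat = (\<lambda>p\<in>obj (mu_shape (msrc m)). mnat (mnat m (vfst p)) (vsnd p))\<rparr>"

definition mu :: "('o, 'a) cat \<Rightarrow>
    (('u::universe, ('u, 'o, 'a) dgm, ('u, 'o, 'a) dmor) dgm,
     ('u, ('u, 'o, 'a) dgm, ('u, 'o, 'a) dmor) dmor, ('u, 'o, 'a) dgm, ('u, 'o, 'a) dmor) ftor"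
  where "mu C = \<lparr>fob = (\<lambda>D\<in>obj (Diag (Diag C)). mu_dgm C D),
                 far = (\<lambda>m\<in>arr (Diag (Diag C)). mu_dmor C m)\<rparr>"

section \<open>Right unitor and associator\<close>

text \<open>
  The isomorphism of diagrams from \<open>D\<close> to \<open>D'\<close> with identity components, for an isomorphism \<open>R\<close>
  of indexing categories over which \<open>D\<close> is the reindexing of \<open>D'\<close>.
\<close>

definition reindexing :: "('o, 'a) cat \<Rightarrow> ('u::universe, 'o, 'a) dgm \<Rightarrow> ('u, 'o, 'a) dgm \<Rightarrow>
    ('u, 'u, 'u, 'u) ftor \<Rightarrow> ('u, 'o, 'a) dmor"
  where "reindexing C D D' R = \<lparr>msrc = D, mtgt = D', mfun = R,
    mnat = (\<lambda>x\<in>obj (shape D). idn C (fob (dfun D) x))\<rparr>"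

definition runit :: "('o, 'a) cat \<Rightarrow> ('u::universe, 'o, 'a) dgm \<Rightarrow> ('u, 'o, 'a) dmor"
  where "runit C = (\<lambda>D\<in>obj (Diag C).
    reindexing C D (fob (mu C) (fob (star C (eta C)) D))
      \<lparr>fob = (\<lambda>X\<in>obj (shape D). vpair X pt), far = (\<lambda>f\<in>arr (shape D). garr pt f pt)\<rparr>)"

text \<open>On arrows, the associator sends \<open>(j, (k, l))\<close> to \<open>((j, k), l)\<close>.\<close>

definition assoc_ftor :: "('u::universe, 'u) cat \<Rightarrow> ('u, 'u, 'u, 'u) ftor"
  where "assoc_ftor S = \<lparr>
    fob = (\<lambda>p\<in>obj S. vpair (vpair (vfst p) (vfst (vsnd p))) (vsnd (vsnd p))),
    far = (\<lambda>a\<in>arr S. garr (vsnd (gpt a)) (garr (vfst (gpt a)) (gbase a) (gbase (gfib a)))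
                          (gfib (gfib a)))\<rparr>"

definition assoc :: "('o, 'a) cat \<Rightarrow>
    ('u::universe, ('u, ('u, 'o, 'a) dgm, ('u, 'o, 'a) dmor) dgm,
      ('u, ('u, 'o, 'a) dgm, ('u, 'o, 'a) dmor) dmor) dgm \<Rightarrow> ('u, 'o, 'a) dmor"
  where "assoc C = (\<lambda>D\<in>obj (Diag (Diag (Diag C))).
    let D1 = fob (mu C) (fob (star (Diag (Diag C)) (mu C)) D);
        D2 = fob (mu C) (fob (mu (Diag C)) D)
    in reindexing C D1 D2 (assoc_ftor (shape D1)))"

section \<open>Pseudoalgebras\<close>

definition pseudoalgebra :: "('o, 'a) cat \<Rightarrow>
    (('u::universe, 'o, 'a) dgm, ('u, 'o, 'a) dmor, 'o, 'a) ftor \<Rightarrow> ('o \<Rightarrow> 'a) \<Rightarrow>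
    (('u, ('u, 'o, 'a) dgm, ('u, 'o, 'a) dmor) dgm \<Rightarrow> 'a) \<Rightarrow> bool"
  where "pseudoalgebra A e \<iota> \<gamma> \<longleftrightarrow>
    (let DA = Diag A; DDA = Diag DA; DDDA = Diag DDA;
         e1 = star DA e; e2 = star DDA e1 in
     category A \<and> locally_small TYPE('u) A \<and>
     is_functor DA A e \<and>
     is_nat_iso A A (comp_functor A e (eta A)) (id_functor A) \<iota> \<and>
     is_nat_iso DDA A (comp_functor DDA e e1) (comp_functor DDA e (mu A)) \<gamma> \<and>
     whisker_right DA \<gamma> (star A (eta A)) =
       vcomp DA A (whisker_left DA e (runit A))
         (whisker_left DA e (nat_star A (comp_functor A e (eta A)) (id_functor A) \<iota>)) \<and>
     vcomp DDDA A (whisker_left DDDA e (assoc A))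
       (vcomp DDDA A (whisker_right DDDA \<gamma> (star DDA (mu A)))
         (whisker_left DDDA e (nat_star DDA (comp_functor DDA e e1) (comp_functor DDA e (mu A)) \<gamma>))) =
       vcomp DDDA A (whisker_right DDDA \<gamma> (mu DA)) (whisker_right DDDA \<gamma> e2))"

section \<open>Colimits\<close>

definition is_cocone :: "('o, 'a) cat \<Rightarrow> ('u::universe, 'o, 'a) dgm \<Rightarrow> 'o \<Rightarrow> ('u \<Rightarrow> 'a) \<Rightarrow> bool"
  where "is_cocone C D v \<kappa> \<longleftrightarrow> v \<in> obj C \<and>
    is_nat (shape D) C (dfun D) (const_functor (shape D) C v) \<kappa>"

definition is_colimit :: "('o, 'a) cat \<Rightarrow> ('u::universe, 'o, 'a) dgm \<Rightarrow> 'o \<Rightarrow> ('u \<Rightarrow> 'a) \<Rightarrow> bool"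
  where "is_colimit C D v \<kappa> \<longleftrightarrow> is_cocone C D v \<kappa> \<and>
    (\<forall>w \<tau>. is_cocone C D w \<tau> \<longrightarrow>
       (\<exists>!h. h \<in> hom C v w \<and> (\<forall>x\<in>obj (shape D). cmp C h (\<kappa> x) = \<tau> x)))"

definition cocomplete :: "'u::universe itself \<Rightarrow> ('o, 'a) cat \<Rightarrow> bool"
  where "cocomplete U C \<longleftrightarrow> category C \<and> locally_small U C \<and>
    (\<forall>D :: ('u, 'o, 'a) dgm. is_dgm C D \<longrightarrow> (\<exists>v \<kappa>. is_colimit C D v \<kappa>))"

definition colimit_choice :: "('o, 'a) cat \<Rightarrow> (('u::universe, 'o, 'a) dgm \<Rightarrow> 'o) \<Rightarrow>
    (('u, 'o, 'a) dgm \<Rightarrow> 'u \<Rightarrow> 'a) \<Rightarrow> bool"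
  where "colimit_choice C v \<kappa> \<longleftrightarrow> (\<forall>D. is_dgm C D \<longrightarrow> is_colimit C D (v D) (\<kappa> D))"

text \<open>
  The functor induced by a choice of colimits: chosen vertices on objects, and on a morphism
  \<open>(R, \<rho>)\<close> the comparison arrow determined by the universal property.
\<close>

definition is_colimit_functor :: "('o, 'a) cat \<Rightarrow> (('u::universe, 'o, 'a) dgm \<Rightarrow> 'o) \<Rightarrow>
    (('u, 'o, 'a) dgm \<Rightarrow> 'u \<Rightarrow> 'a) \<Rightarrow> (('u, 'o, 'a) dgm, ('u, 'o, 'a) dmor, 'o, 'a) ftor \<Rightarrow> bool"
  where "is_colimit_functor C v \<kappa> e \<longleftrightarrow> is_functor (Diag C) C e \<and>
    (\<forall>D. is_dgm C D \<longrightarrow> fob e D = v D) \<and>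
    (\<forall>m. is_dmor C m \<longrightarrow> (\<forall>x\<in>obj (shape (msrc m)).
       cmp C (far e m) (\<kappa> (msrc m) x) =
       cmp C (\<kappa> (mtgt m) (fob (mfun m) x)) (mnat m x)))"

end

theory Submission
  imports Defs
begin

text \<open>
  Write \<open>\<kappa> D\<close> for the chosen colimit cocone of \<open>D\<close>. The functor \<open>e\<close> takes the chosen colimit, \<open>\<iota>\<close>
  inverts the cocone of a one-point diagram, and \<open>\<gamma>\<close> at \<open>D\<close> is the unique arrow with
  \<open>\<gamma> D \<cdot> \<kappa> (e\<^sub>* D) x \<cdot> \<kappa> (D x) y = \<kappa> (\<mu> D) (x, y)\<close>: a colimit over a Grothendieck construction
  is an iterated colimit. Cocones are jointly epic, and so are composites of two or three of
  them; precomposing with these turns naturality and both coherence equations into identities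
  between legs of a single colimit cocone.
\<close>

section \<open>Categories and functors\<close>

text \<open>Two obstacles shape the proof. A choice of colimits need not respect isomorphisms of
  diagrams, so legs of chosen cocones can be compared only if the diagrams involved are literally
  equal. Extensional structure maps make such equalities provable; \<open>mu_push_star\<close>,
  \<open>push_dgm_comp\<close> and \<open>push_dgm_id\<close> supply those on which the coherence
  laws depend. The source of \<gamma> is a colimit of colimits, so no single universal property
  yields \<gamma>. Every arrow of the Grothendieck construction factors as an opcartesian arrow
  \<open>(j, id)\<close> followed by a vertical one \<open>(id, f)\<close>. Compatibility with
  vertical arrows gives an arrow out of each inner colimit, and compatibility with opcartesian ones
  makes these arrows a cocone on the outer diagram. The inverse of \<gamma> comes from one cocone
  over the whole Grothendieck construction. In the calculations with colimits composites are nested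
  to the right. A law about legs therefore often has a second form with a trailing factor
  \<open>g\<close>, and premises such as \<open>msrc m = D\<close> let it match diagrams that are
  only provably equal.\<close>

lemma categoryD:
  assumes "category C"
  shows "f \<in> arr C \<Longrightarrow> src C f \<in> obj C"
    and "f \<in> arr C \<Longrightarrow> tgt C f \<in> obj C"
    and "x \<in> obj C \<Longrightarrow> idn C x \<in> arr C"
    and "x \<in> obj C \<Longrightarrow> src C (idn C x) = x"
    and "x \<in> obj C \<Longrightarrow> tgt C (idn C x) = x"
    and "f \<in> arr C \<Longrightarrow> g \<in> arr C \<Longrightarrow> src C g = tgt C f \<Longrightarrow> cmp C g f \<in> arr C"
    and "f \<in> arr C \<Longrightarrow> g \<in> arr C \<Longrightarrow> src C g = tgt C f \<Longrightarrow> src C (cmp C g f) = src C f"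
    and "f \<in> arr C \<Longrightarrow> g \<in> arr C \<Longrightarrow> src C g = tgt C f \<Longrightarrow> tgt C (cmp C g f) = tgt C g"
    and "f \<in> arr C \<Longrightarrow> src C f = x \<Longrightarrow> cmp C f (idn C x) = f"
    and "f \<in> arr C \<Longrightarrow> tgt C f = x \<Longrightarrow> cmp C (idn C x) f = f"
proof -
  show src: "f \<in> arr C \<Longrightarrow> src C f \<in> obj C"
    and tgt: "f \<in> arr C \<Longrightarrow> tgt C f \<in> obj C" for f
    using assms by (auto simp: category_def PiE_iff)
  show "x \<in> obj C \<Longrightarrow> idn C x \<in> arr C" "x \<in> obj C \<Longrightarrow> src C (idn C x) = x"
    "x \<in> obj C \<Longrightarrow> tgt C (idn C x) = x"
    using assms by (auto simp: category_def PiE_iff hom_def)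
  have "cmp C g f \<in> hom C (src C f) (tgt C g)"
    if "f \<in> arr C" "g \<in> arr C" "src C g = tgt C f"
  proof -
    have "\<forall>x\<in>obj C. \<forall>y\<in>obj C. \<forall>z\<in>obj C. \<forall>f\<in>hom C x y. \<forall>g\<in>hom C y z. cmp C g f \<in> hom C x z"
      using assms by (simp add: category_def)
    moreover have "f \<in> hom C (src C f) (tgt C f)" "g \<in> hom C (tgt C f) (tgt C g)"
      using that by (auto simp: hom_def)
    ultimately show ?thesis using src tgt that by blast
  qed
  then show "f \<in> arr C \<Longrightarrow> g \<in> arr C \<Longrightarrow> src C g = tgt C f \<Longrightarrow> cmp C g f \<in> arr C"
    "f \<in> arr C \<Longrightarrow> g \<in> arr C \<Longrightarrow> src C g = tgt C f \<Longrightarrow> src C (cmp C g f) = src C f"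
    "f \<in> arr C \<Longrightarrow> g \<in> arr C \<Longrightarrow> src C g = tgt C f \<Longrightarrow> tgt C (cmp C g f) = tgt C g"
    by (auto simp: hom_def)
  show "f \<in> arr C \<Longrightarrow> src C f = x \<Longrightarrow> cmp C f (idn C x) = f"
    "f \<in> arr C \<Longrightarrow> tgt C f = x \<Longrightarrow> cmp C (idn C x) f = f"
    using assms by (auto simp: category_def)
qed

lemma category_assoc:
  assumes "category C" "f \<in> arr C" "g \<in> arr C" "h \<in> arr C"
    "src C g = tgt C f" "src C h = tgt C g"
  shows "cmp C (cmp C h g) f = cmp C h (cmp C g f)"
  using assms by (simp add: category_def)

lemma categoryI:
  assumes "src C \<in> extensional (arr C)" "tgt C \<in> extensional (arr C)" "idn C \<in> extensional (obj C)"
    and "\<And>f. f \<in> arr C \<Longrightarrow> src C f \<in> obj C" "\<And>f. f \<in> arr C \<Longrightarrow> tgt C f \<in> obj C"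
    and "\<And>x. x \<in> obj C \<Longrightarrow> idn C x \<in> arr C" "\<And>x. x \<in> obj C \<Longrightarrow> src C (idn C x) = x"
      "\<And>x. x \<in> obj C \<Longrightarrow> tgt C (idn C x) = x"
    and "\<And>g f. \<not> (g \<in> arr C \<and> f \<in> arr C \<and> src C g = tgt C f) \<Longrightarrow> cmp C g f = undefined"
    and cmp: "\<And>g f. f \<in> arr C \<Longrightarrow> g \<in> arr C \<Longrightarrow> src C g = tgt C f \<Longrightarrow> cmp C g f \<in> hom C (src C f) (tgt C g)"
    and "\<And>f. f \<in> arr C \<Longrightarrow> cmp C f (idn C (src C f)) = f"
    and "\<And>f. f \<in> arr C \<Longrightarrow> cmp C (idn C (tgt C f)) f = f"
    and "\<And>f g h. f \<in> arr C \<Longrightarrow> g \<in> arr C \<Longrightarrow> h \<in> arr C \<Longrightarrow> src C g = tgt C f \<Longrightarrow> src C h = tgt C g \<Longrightarrow>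
       cmp C h (cmp C g f) = cmp C (cmp C h g) f"
  shows "category C"
  unfolding category_def
proof (intro conjI)
  show "\<forall>x\<in>obj C. \<forall>y\<in>obj C. \<forall>z\<in>obj C. \<forall>f\<in>hom C x y. \<forall>g\<in>hom C y z. cmp C g f \<in> hom C x z"
    using cmp by (fastforce simp: hom_def)
qed (use assms in \<open>simp_all add: PiE_iff hom_def\<close>)

lemma is_functorD:
  assumes "is_functor C D F"
  shows "x \<in> obj C \<Longrightarrow> fob F x \<in> obj D"
    and "f \<in> arr C \<Longrightarrow> far F f \<in> arr D"
    and "f \<in> arr C \<Longrightarrow> src D (far F f) = fob F (src C f)"
    and "f \<in> arr C \<Longrightarrow> tgt D (far F f) = fob F (tgt C f)"
    and "x \<in> obj C \<Longrightarrow> far F (idn C x) = idn D (fob F x)"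
    and "f \<in> arr C \<Longrightarrow> g \<in> arr C \<Longrightarrow> src C g = tgt C f \<Longrightarrow>
       far F (cmp C g f) = cmp D (far F g) (far F f)"
  using assms by (auto simp: is_functor_def PiE_iff hom_def)

lemma functor_category:
  assumes "is_functor C D F"
  shows "category C" "category D"
  using assms by (auto simp: is_functor_def)

lemma functor_extensional:
  assumes "is_functor C D F"
  shows "fob F \<in> extensional (obj C)" "far F \<in> extensional (arr C)"
  using assms by (auto simp: is_functor_def PiE_iff)

lemma is_functorI:
  assumes "category C" "category D" "fob F \<in> extensional (obj C)" "far F \<in> extensional (arr C)"
    and "\<And>x. x \<in> obj C \<Longrightarrow> fob F x \<in> obj D"
    and "\<And>f. f \<in> arr C \<Longrightarrow> far F f \<in> arr D"
    and "\<And>f. f \<in> arr C \<Longrightarrow> src D (far F f) = fob F (src C f)"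
    and "\<And>f. f \<in> arr C \<Longrightarrow> tgt D (far F f) = fob F (tgt C f)"
    and "\<And>x. x \<in> obj C \<Longrightarrow> far F (idn C x) = idn D (fob F x)"
    and "\<And>f g. f \<in> arr C \<Longrightarrow> g \<in> arr C \<Longrightarrow> src C g = tgt C f \<Longrightarrow>
       far F (cmp C g f) = cmp D (far F g) (far F f)"
  shows "is_functor C D F"
  using assms by (auto simp: is_functor_def PiE_iff hom_def)

lemma functor_eqI:
  fixes F G :: "('o, 'a, 'p, 'b) ftor"
  assumes "fob F \<in> extensional A" "fob G \<in> extensional A" "far F \<in> extensional B" "far G \<in> extensional B"
    and "\<And>x. x \<in> A \<Longrightarrow> fob F x = fob G x" "\<And>f. f \<in> B \<Longrightarrow> far F f = far G f"
  shows "F = G"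
proof -
  have "fob F = fob G" "far F = far G"
    using assms by (auto intro: extensionalityI)
  then show ?thesis by simp
qed

lemma comp_functor_simps:
  "x \<in> obj C \<Longrightarrow> fob (comp_functor C G F) x = fob G (fob F x)"
  "f \<in> arr C \<Longrightarrow> far (comp_functor C G F) f = far G (far F f)"
  "fob (comp_functor C G F) \<in> extensional (obj C)"
  "far (comp_functor C G F) \<in> extensional (arr C)"
  by (simp_all add: comp_functor_def compose_def)

lemma id_functor_simps:
  "x \<in> obj C \<Longrightarrow> fob (id_functor C) x = x"
  "f \<in> arr C \<Longrightarrow> far (id_functor C) f = f"
  "fob (id_functor C) \<in> extensional (obj C)"
  "far (id_functor C) \<in> extensional (arr C)"
  by (simp_all add: id_functor_def)

lemma const_functor_simps:
  "x \<in> obj C \<Longrightarrow> fob (const_functor C D y) x = y"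
  "f \<in> arr C \<Longrightarrow> far (const_functor C D y) f = idn D y"
  "fob (const_functor C D y) \<in> extensional (obj C)"
  "far (const_functor C D y) \<in> extensional (arr C)"
  by (simp_all add: const_functor_def)

lemma is_functor_comp:
  assumes "is_functor C D F" "is_functor D E G"
  shows "is_functor C E (comp_functor C G F)"
  by (rule is_functorI)
    (simp_all add: comp_functor_simps is_functorD[OF assms(1)] is_functorD[OF assms(2)]
      functor_category[OF assms(1)] functor_category[OF assms(2)] categoryD[OF functor_category(1)[OF assms(1)]])

lemma is_functor_id:
  assumes "category C"
  shows "is_functor C C (id_functor C)"
  by (rule is_functorI) (simp_all add: id_functor_simps assms categoryD[OF assms])

lemma is_functor_const:
  assumes "category C" "category D" "y \<in> obj D"
  shows "is_functor C D (const_functor C D y)"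
  by (rule is_functorI)
    (simp_all add: const_functor_simps assms categoryD[OF assms(1)] categoryD[OF assms(2)])

lemma comp_functor_id_right:
  assumes "is_functor C D F"
  shows "comp_functor C F (id_functor C) = F"
  by (rule functor_eqI[of _ "obj C" _ "arr C"])
    (simp_all add: functor_extensional[OF assms] comp_functor_simps id_functor_simps)

lemma comp_functor_id_left:
  assumes "is_functor C D F"
  shows "comp_functor C (id_functor D) F = F"
  by (rule functor_eqI[of _ "obj C" _ "arr C"])
    (simp_all add: functor_extensional[OF assms] comp_functor_simps id_functor_simps is_functorD[OF assms])

lemma comp_functor_assoc:
  assumes "is_functor C D F"
  shows "comp_functor C (comp_functor D H G) F = comp_functor C H (comp_functor C G F)"
  by (rule functor_eqI[of _ "obj C" _ "arr C"])
    (simp_all add: comp_functor_simps is_functorD[OF assms])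

lemma is_natD:
  assumes "is_nat C D F G \<alpha>"
  shows "x \<in> obj C \<Longrightarrow> \<alpha> x \<in> arr D"
    and "x \<in> obj C \<Longrightarrow> src D (\<alpha> x) = fob F x"
    and "x \<in> obj C \<Longrightarrow> tgt D (\<alpha> x) = fob G x"
    and "f \<in> arr C \<Longrightarrow> cmp D (\<alpha> (tgt C f)) (far F f) = cmp D (far G f) (\<alpha> (src C f))"
  using assms by (auto simp: is_nat_def PiE_iff hom_def)

lemma is_nat_functors:
  assumes "is_nat C D F G \<alpha>"
  shows "is_functor C D F" "is_functor C D G" "\<alpha> \<in> extensional (obj C)"
  using assms by (auto simp: is_nat_def PiE_iff)

lemma is_natI:
  assumes "is_functor C D F" "is_functor C D G" "\<alpha> \<in> extensional (obj C)"
    and "\<And>x. x \<in> obj C \<Longrightarrow> \<alpha> x \<in> hom D (fob F x) (fob G x)"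
    and "\<And>f. f \<in> arr C \<Longrightarrow> cmp D (\<alpha> (tgt C f)) (far F f) = cmp D (far G f) (\<alpha> (src C f))"
  shows "is_nat C D F G \<alpha>"
  using assms by (auto simp: is_nat_def PiE_iff hom_def)

section \<open>Diagrams\<close>

lemma Diag_simps:
  "obj (Diag C) = Collect (is_dgm C)"
  "arr (Diag C) = Collect (is_dmor C)"
  "is_dmor C m \<Longrightarrow> src (Diag C) m = msrc m"
  "is_dmor C m \<Longrightarrow> tgt (Diag C) m = mtgt m"
  by (simp_all add: Diag_def)

lemma is_dgmD:
  assumes "is_dgm C D"
  shows "small_category (shape D)" "category (shape D)" "is_functor (shape D) C (dfun D)" "category C"
  using assms by (auto simp: is_dgm_def small_category_def is_functor_def)

lemma is_dmorD:
  assumes "is_dmor C m"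
  shows "is_dgm C (msrc m)" "is_dgm C (mtgt m)"
    and "is_functor (shape (msrc m)) (shape (mtgt m)) (mfun m)"
    and "mnat m \<in> extensional (obj (shape (msrc m)))"
    and "x \<in> obj (shape (msrc m)) \<Longrightarrow> mnat m x \<in> arr C"
    and "x \<in> obj (shape (msrc m)) \<Longrightarrow> src C (mnat m x) = fob (dfun (msrc m)) x"
    and "x \<in> obj (shape (msrc m)) \<Longrightarrow> tgt C (mnat m x) = fob (dfun (mtgt m)) (fob (mfun m) x)"
    and "f \<in> arr (shape (msrc m)) \<Longrightarrow>
      cmp C (mnat m (tgt (shape (msrc m)) f)) (far (dfun (msrc m)) f) =
      cmp C (far (dfun (mtgt m)) (far (mfun m) f)) (mnat m (src (shape (msrc m)) f))"
proof -
  have nat: "is_nat (shape (msrc m)) C (dfun (msrc m))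
      (comp_functor (shape (msrc m)) (dfun (mtgt m)) (mfun m)) (mnat m)"
    using assms by (simp add: is_dmor_def)
  show "is_dgm C (msrc m)" "is_dgm C (mtgt m)"
    "is_functor (shape (msrc m)) (shape (mtgt m)) (mfun m)"
    using assms by (auto simp: is_dmor_def)
  show "mnat m \<in> extensional (obj (shape (msrc m)))"
    "x \<in> obj (shape (msrc m)) \<Longrightarrow> mnat m x \<in> arr C"
    "x \<in> obj (shape (msrc m)) \<Longrightarrow> src C (mnat m x) = fob (dfun (msrc m)) x"
    "x \<in> obj (shape (msrc m)) \<Longrightarrow> tgt C (mnat m x) = fob (dfun (mtgt m)) (fob (mfun m) x)"
    "f \<in> arr (shape (msrc m)) \<Longrightarrow>
      cmp C (mnat m (tgt (shape (msrc m)) f)) (far (dfun (msrc m)) f) =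
      cmp C (far (dfun (mtgt m)) (far (mfun m) f)) (mnat m (src (shape (msrc m)) f))"
    using is_natD[OF nat] is_nat_functors[OF nat] by (simp_all add: comp_functor_simps)
qed

lemma is_dmorI:
  assumes "is_dgm C (msrc m)" "is_dgm C (mtgt m)"
    and "is_functor (shape (msrc m)) (shape (mtgt m)) (mfun m)"
    and "mnat m \<in> extensional (obj (shape (msrc m)))"
    and "\<And>x. x \<in> obj (shape (msrc m)) \<Longrightarrow>
      mnat m x \<in> hom C (fob (dfun (msrc m)) x) (fob (dfun (mtgt m)) (fob (mfun m) x))"
    and "\<And>f. f \<in> arr (shape (msrc m)) \<Longrightarrow>
      cmp C (mnat m (tgt (shape (msrc m)) f)) (far (dfun (msrc m)) f) =
      cmp C (far (dfun (mtgt m)) (far (mfun m) f)) (mnat m (src (shape (msrc m)) f))"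
  shows "is_dmor C m"
  unfolding is_dmor_def
  using assms is_functor_comp[OF assms(3) is_dgmD(3)[OF assms(2)]]
  by (auto intro!: is_natI simp: comp_functor_simps is_dgmD(3) categoryD[OF is_dgmD(2)[OF assms(1)]])

lemma dmor_eqI:
  fixes m n :: "('u, 'o, 'a) dmor"
  assumes "msrc m = msrc n" "mtgt m = mtgt n" "mfun m = mfun n"
    and "mnat m \<in> extensional A" "mnat n \<in> extensional A" "\<And>x. x \<in> A \<Longrightarrow> mnat m x = mnat n x"
  shows "m = n"
proof -
  have "mnat m = mnat n" using assms by (auto intro: extensionalityI)
  then show ?thesis using assms by simp
qed

lemma dgm_eqI:
  fixes D D' :: "('u, 'o, 'a) dgm"
  assumes "shape D = shape D'" "dfun D = dfun D'"
  shows "D = D'"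
  using assms by simp

lemma Diag_idn_simps:
  assumes "is_dgm C D"
  shows "msrc (idn (Diag C) D) = D" "mtgt (idn (Diag C) D) = D"
    "mfun (idn (Diag C) D) = id_functor (shape D)"
    "x \<in> obj (shape D) \<Longrightarrow> mnat (idn (Diag C) D) x = idn C (fob (dfun D) x)"
    "mnat (idn (Diag C) D) \<in> extensional (obj (shape D))"
  using assms by (simp_all add: Diag_def)

lemma Diag_cmp_simps:
  assumes "is_dmor C m" "is_dmor C n" "msrc n = mtgt m"
  shows "msrc (cmp (Diag C) n m) = msrc m" "mtgt (cmp (Diag C) n m) = mtgt n"
    "mfun (cmp (Diag C) n m) = comp_functor (shape (msrc m)) (mfun n) (mfun m)"
    "x \<in> obj (shape (msrc m)) \<Longrightarrow>
      mnat (cmp (Diag C) n m) x = cmp C (mnat n (fob (mfun m) x)) (mnat m x)"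
    "mnat (cmp (Diag C) n m) \<in> extensional (obj (shape (msrc m)))"
  using assms by (simp_all add: Diag_def vcomp_def whisker_right_def compose_def)

lemma is_dmor_idn:
  assumes "is_dgm C D"
  shows "is_dmor C (idn (Diag C) D)"
  by (rule is_dmorI)
    (simp_all add: Diag_idn_simps[OF assms] assms is_functor_id is_dgmD[OF assms] id_functor_simps hom_def
      categoryD[OF is_dgmD(2)[OF assms]] categoryD[OF is_dgmD(4)[OF assms]] is_functorD[OF is_dgmD(3)[OF assms]])

text \<open>Two squares are pasted: that of \<open>m\<close> at \<open>f\<close> and that of
  \<open>n\<close> at the image \<open>far (mfun m) f\<close>.\<close>

lemma is_dmor_cmp:
  assumes m: "is_dmor C m" and n: "is_dmor C n" and mn: "msrc n = mtgt m"
  shows "is_dmor C (cmp (Diag C) n m)"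
proof (rule is_dmorI, unfold Diag_cmp_simps(1-3)[OF assms])
  note ms = is_dmorD[OF m] and ns = is_dmorD[OF n, unfolded mn]
  note md = is_dgmD[OF ms(1)] and mt = is_dgmD[OF ms(2)] and nt = is_dgmD[OF ns(2)]
  note simps = Diag_cmp_simps(4,5)[OF assms] comp_functor_simps hom_def ms ns
    categoryD[OF md(2)] categoryD[OF md(4)] is_functorD[OF ms(3)] is_functorD[OF ns(3)]
    is_functorD[OF md(3)] is_functorD[OF mt(3)] is_functorD[OF nt(3)]
  show "is_functor (shape (msrc m)) (shape (mtgt n)) (comp_functor (shape (msrc m)) (mfun n) (mfun m))"
    by (rule is_functor_comp[OF ms(3) ns(3)])
  show "cmp C (mnat (cmp (Diag C) n m) (tgt (shape (msrc m)) f)) (far (dfun (msrc m)) f) =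
         cmp C (far (dfun (mtgt n)) (far (comp_functor (shape (msrc m)) (mfun n) (mfun m)) f))
          (mnat (cmp (Diag C) n m) (src (shape (msrc m)) f))" if f: "f \<in> arr (shape (msrc m))" for f
  proof -
    let ?D = "msrc m" let ?E = "mtgt m" let ?G = "mtgt n"
    let ?x = "src (shape ?D) f" let ?y = "tgt (shape ?D) f"
    have "cmp C (mnat (cmp (Diag C) n m) ?y) (far (dfun ?D) f) =
      cmp C (mnat n (fob (mfun m) ?y)) (cmp C (mnat m ?y) (far (dfun ?D) f))"
      using f by (simp add: simps category_assoc[OF md(4)])
    also have "\<dots> = cmp C (cmp C (mnat n (fob (mfun m) ?y)) (far (dfun ?E) (far (mfun m) f))) (mnat m ?x)"
      using f by (simp add: simps category_assoc[OF md(4)])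
    also have "\<dots> = cmp C (cmp C (far (dfun ?G) (far (mfun n) (far (mfun m) f))) (mnat n (fob (mfun m) ?x))) (mnat m ?x)"
      using f ns(8)[of "far (mfun m) f"] by (simp add: simps)
    finally show ?thesis using f by (simp add: simps category_assoc[OF md(4)])
  qed
qed (use assms in \<open>auto simp: is_dmorD Diag_cmp_simps comp_functor_simps hom_def
  categoryD[OF is_dgmD(4)[OF is_dmorD(1)]] is_functorD[OF is_dmorD(3)[OF m]] is_dmorD[OF n, unfolded mn]\<close>)

lemma Diag_cmp_undefined:
  "\<not> (is_dmor C n \<and> is_dmor C m \<and> msrc n = mtgt m) \<Longrightarrow> cmp (Diag C) n m = undefined"
  by (auto simp: Diag_def)

lemma category_Diag:
  fixes C :: "('o, 'a) cat"
  assumes "category C"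
  shows "category (Diag C :: (('u::universe, 'o, 'a) dgm, _) cat)"
proof (rule categoryI, goal_cases)
  \<comment> \<open>Case 9 is the default value of \<open>cmp\<close> off composable pairs. Cases
    11, 12 and 13 are the unit laws and associativity, which reduce to the same laws for functors
    and for \<open>C\<close>.\<close>
  case (9 g f) then show ?case by (auto intro!: Diag_cmp_undefined simp: Diag_simps)
next
  case (11 f)
  then have f: "is_dmor C f" by (simp add: Diag_simps)
  note fs = is_dmorD[OF f] and fd = is_dgmD[OF is_dmorD(1)[OF f]]
  note c = Diag_cmp_simps[OF is_dmor_idn[OF fs(1)] f, simplified Diag_idn_simps[OF fs(1)], OF refl]
  show ?case unfolding Diag_simps(3)[OF f]
    by (rule dmor_eqI[of _ _ "obj (shape (msrc f))"])
      (simp_all add: c fs Diag_idn_simps[OF fs(1)] comp_functor_id_right[OF fs(3)] id_functor_simps categoryD[OF fd(4)])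
next
  case (12 f)
  then have f: "is_dmor C f" by (simp add: Diag_simps)
  note fs = is_dmorD[OF f] and fd = is_dgmD[OF is_dmorD(1)[OF f]]
  note c = Diag_cmp_simps[OF f is_dmor_idn[OF fs(2)], simplified Diag_idn_simps[OF fs(2)], OF refl]
  show ?case unfolding Diag_simps(4)[OF f]
    by (rule dmor_eqI[of _ _ "obj (shape (msrc f))"])
      (simp_all add: c fs Diag_idn_simps[OF fs(2)] comp_functor_id_left[OF fs(3)] id_functor_simps categoryD[OF fd(4)]
         is_functorD[OF fs(3)])
next
  case (13 f g h)
  then have f: "is_dmor C f" and g: "is_dmor C g" and h: "is_dmor C h"
    and fg: "msrc g = mtgt f" and gh: "msrc h = mtgt g"
    by (auto simp: Diag_simps)
  note fs = is_dmorD[OF f] and gs = is_dmorD[OF g, unfolded fg] and hs = is_dmorD[OF h, unfolded gh]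
    and fd = is_dgmD[OF is_dmorD(1)[OF f]]
  note c = Diag_cmp_simps[OF f g fg] Diag_cmp_simps[OF g h gh]
    Diag_cmp_simps[OF is_dmor_cmp[OF f g fg] h, simplified Diag_cmp_simps[OF f g fg], OF gh]
    Diag_cmp_simps[OF f is_dmor_cmp[OF g h gh], simplified Diag_cmp_simps[OF g h gh], OF fg]
  show ?case
    by (rule dmor_eqI[of _ _ "obj (shape (msrc f))"])
      (simp_all add: c fs fg comp_functor_assoc[OF fs(3)] category_assoc[OF assms] comp_functor_simps
         gs hs is_functorD[OF fs(3)] is_functorD[OF gs(3)])
qed (auto simp: Diag_simps is_dmorD Diag_idn_simps is_dmor_idn hom_def Diag_cmp_simps is_dmor_cmp,
   auto simp: Diag_def)

section \<open>Small sets and the Grothendieck construction\<close>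

lemma elts_vset: "small A \<Longrightarrow> elts (vset A) = A"
  unfolding small_def vset_def by (rule f_inv_into_f)

lemma vset_inject:
  assumes "small A" "small B"
  shows "vset A = vset B \<longleftrightarrow> A = B"
  using arg_cong[of "vset A" "vset B" elts] unfolding elts_vset[OF assms(1)] elts_vset[OF assms(2)] by blast

lemma small_elts: "small (elts x)"
  by (simp add: small_def)

lemma small_subset:
  assumes "small A" "B \<subseteq> A"
  shows "small B"
proof -
  obtain x where "A = elts x" using assms(1) by (auto simp: small_def)
  then obtain y where "elts y = B" using elts_subset[of B x] assms(2) by auto
  then show ?thesis using small_elts[of y] by simp
qed

lemma small_image:
  fixes f :: "'u::universe \<Rightarrow> 'u"
  assumes "small A"
  shows "small (f ` A)"
proof -
  obtain x where "A = elts x" using assms by (auto simp: small_def)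
  then obtain y where "elts y = f ` A" using elts_replacement[of f x] by auto
  then show ?thesis using small_elts[of y] by simp
qed

text \<open>\<open>elts_Union\<close> takes a union over the members of an element of the universe,
  so the family is first coded as the small set of its values \<open>vset (f x)\<close>.\<close>

lemma small_UN:
  fixes f :: "'u::universe \<Rightarrow> 'u set"
  assumes "small A" "\<And>x. x \<in> A \<Longrightarrow> small (f x)"
  shows "small (\<Union>x\<in>A. f x)"
proof -
  have "small ((\<lambda>x. vset (f x)) ` A)" using assms by (intro small_image)
  then obtain z where "elts z = (\<lambda>x. vset (f x)) ` A" by (auto simp: small_def image_iff)
  moreover obtain y where "elts y = (\<Union>z\<in>elts z. elts z)" using elts_Union by blast
  ultimately have "elts y = (\<Union>x\<in>A. f x)" using assms by (auto simp: elts_vset)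
  then show ?thesis using small_elts[of y] by simp
qed

lemma small_empty: "small {}"
  by (rule small_subset[OF small_elts]) simp

text \<open>The axioms contain no pairing. The double power set of the empty set is small and has
  two distinct members, the codes of the empty set and of its power set; replacement maps one to
  \<open>a\<close> and the rest to \<open>b\<close>.\<close>

lemma small_doubleton: "small {a :: 'u::universe, b}"
proof -
  have pow: "small {z. elts z \<subseteq> A}" if "small A" for A :: "'u set"
    using elts_Pow[of "vset A"] elts_vset[OF that] by (auto simp: small_def image_iff intro: sym)
  let ?P = "{z :: 'u. elts z \<subseteq> {z. elts z \<subseteq> {}}}"
  have P: "small ?P" by (intro pow small_empty)
  have s: "small {z :: 'u. elts z \<subseteq> {}}" by (intro pow small_empty)
  define e :: 'u where "e = vset {}"
  define f :: 'u where "f = vset {z. elts z \<subseteq> {}}"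
  have ee: "elts e = {}" and ef: "elts f = {z. elts z \<subseteq> {}}"
    by (simp_all only: e_def f_def elts_vset[OF small_empty] elts_vset[OF s])
  have "e \<in> ?P" "f \<in> ?P" using ee ef by auto
  moreover have "e \<noteq> f" using ee ef by (metis empty_iff mem_Collect_eq subset_refl)
  ultimately have "{a, b} \<subseteq> (\<lambda>z. if z = e then a else b) ` ?P" by force
  with small_image[OF P] show ?thesis by (rule small_subset)
qed

lemma small_singleton: "small {a}"
  using small_doubleton[of a a] by simp

text \<open>Kuratowski's argument. Codes are compared through \<open>vset_inject\<close>, which asks
  for small sets; hence the closure under singletons and doubletons beforehand.\<close>

lemma vpair_eq_iff [simp]: "vpair a b = vpair c d \<longleftrightarrow> a = c \<and> b = d"
  by (auto simp: vpair_def vset_inject small_doubleton small_singleton doubleton_eq_iff)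

lemma vfst_vpair [simp]: "vfst (vpair a b) = a"
  by (simp add: vfst_def)

lemma vsnd_vpair [simp]: "vsnd (vpair a b) = b"
  by (simp add: vsnd_def)

section \<open>The Grothendieck construction of an indexed small category\<close>

lemma garr_simps [simp]:
  "gpt (garr X j f) = X" "gbase (garr X j f) = j" "gfib (garr X j f) = f"
  "garr X j f = garr X' j' f' \<longleftrightarrow> X = X' \<and> j = j' \<and> f = f'"
  by (auto simp: garr_def gpt_def gbase_def gfib_def)

text \<open>A strict functor from \<open>J\<close> to small categories, with \<open>K\<close> its
  action on objects and \<open>T\<close> its action on arrows.\<close>

definition indexed_cat :: "('u::universe, 'u) cat \<Rightarrow> ('u \<Rightarrow> ('u, 'u) cat) \<Rightarrow>
    ('u \<Rightarrow> ('u, 'u, 'u, 'u) ftor) \<Rightarrow> bool"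
  where "indexed_cat J K T \<longleftrightarrow> small_category J \<and> (\<forall>x\<in>obj J. small_category (K x)) \<and>
    (\<forall>j\<in>arr J. is_functor (K (src J j)) (K (tgt J j)) (T j)) \<and>
    (\<forall>x\<in>obj J. T (idn J x) = id_functor (K x)) \<and>
    (\<forall>f\<in>arr J. \<forall>g\<in>arr J. src J g = tgt J f \<longrightarrow>
      T (cmp J g f) = comp_functor (K (src J f)) (T g) (T f))"

lemma groth_sel:
  "obj (groth J K T) = groth_obj J K" "arr (groth J K T) = groth_arr J K T"
  by (simp_all add: groth_def)

lemma groth_obj_iff [simp]: "vpair x X \<in> groth_obj J K \<longleftrightarrow> x \<in> obj J \<and> X \<in> obj (K x)"
  by (auto simp: groth_obj_def)

lemma groth_arr_iff [simp]: "garr X j f \<in> groth_arr J K T \<longleftrightarrow> j \<in> arr J \<and> X \<in> obj (K (src J j)) \<and>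
    f \<in> arr (K (tgt J j)) \<and> src (K (tgt J j)) f = fob (T j) X"
  by (auto simp: groth_arr_def)

lemma groth_objE:
  assumes "p \<in> groth_obj J K"
  obtains x X where "p = vpair x X" "x \<in> obj J" "X \<in> obj (K x)"
  using assms by (auto simp: groth_obj_def)

lemma groth_arrE:
  assumes "a \<in> groth_arr J K T"
  obtains X j f where "a = garr X j f" "j \<in> arr J" "X \<in> obj (K (src J j))" "f \<in> arr (K (tgt J j))"
    "src (K (tgt J j)) f = fob (T j) X"
  using assms by (auto simp: groth_arr_def)

lemma groth_src_garr [simp]: "groth_src J (garr X j f) = vpair (src J j) X"
  by (simp add: groth_src_def)

lemma groth_tgt_garr [simp]: "groth_tgt J K (garr X j f) = vpair (tgt J j) (tgt (K (tgt J j)) f)"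
  by (simp add: groth_tgt_def)

lemma groth_simps:
  "garr X j f \<in> groth_arr J K T \<Longrightarrow> src (groth J K T) (garr X j f) = vpair (src J j) X"
  "garr X j f \<in> groth_arr J K T \<Longrightarrow>
    tgt (groth J K T) (garr X j f) = vpair (tgt J j) (tgt (K (tgt J j)) f)"
  "vpair x X \<in> groth_obj J K \<Longrightarrow> idn (groth J K T) (vpair x X) = garr X (idn J x) (idn (K x) X)"
  "garr X' j' f' \<in> groth_arr J K T \<Longrightarrow> garr X j f \<in> groth_arr J K T \<Longrightarrow>
    src J j' = tgt J j \<Longrightarrow> X' = tgt (K (tgt J j)) f \<Longrightarrow>
    cmp (groth J K T) (garr X' j' f') (garr X j f) =
      garr X (cmp J j' j) (cmp (K (tgt J j')) f' (far (T j') f))"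
  by (simp_all add: groth_def)

text \<open>In the fibre, associativity combines functoriality of the last transition functor with
  the law for \<open>T\<close> on composites; the unit laws use \<open>T\<close> on identities.
  Since these laws of \<open>T\<close> are equalities, the result is a category on the nose.\<close>

lemma category_groth:
  assumes "indexed_cat J K T"
  shows "category (groth J K T)"
proof -
  have J: "category J" and K: "\<And>x. x \<in> obj J \<Longrightarrow> category (K x)"
    and T: "\<And>j. j \<in> arr J \<Longrightarrow> is_functor (K (src J j)) (K (tgt J j)) (T j)"
    and Tid: "\<And>x. x \<in> obj J \<Longrightarrow> T (idn J x) = id_functor (K x)"
    and Tcmp: "\<And>f g. f \<in> arr J \<Longrightarrow> g \<in> arr J \<Longrightarrow> src J g = tgt J f \<Longrightarrow>
      T (cmp J g f) = comp_functor (K (src J f)) (T g) (T f)"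
    using assms by (simp_all add: indexed_cat_def small_category_def)
  note Js = categoryD[OF J] and Ks = categoryD[OF K]
  have Ts: "\<lbrakk>j \<in> arr J; src J j = x; X \<in> obj (K x)\<rbrakk> \<Longrightarrow> fob (T j) X \<in> obj (K (tgt J j))"
    "\<lbrakk>j \<in> arr J; src J j = x; f \<in> arr (K x)\<rbrakk> \<Longrightarrow> far (T j) f \<in> arr (K (tgt J j))"
    "\<lbrakk>j \<in> arr J; src J j = x; f \<in> arr (K x)\<rbrakk> \<Longrightarrow> src (K (tgt J j)) (far (T j) f) = fob (T j) (src (K x) f)"
    "\<lbrakk>j \<in> arr J; src J j = x; f \<in> arr (K x)\<rbrakk> \<Longrightarrow> tgt (K (tgt J j)) (far (T j) f) = fob (T j) (tgt (K x) f)"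
    "\<lbrakk>j \<in> arr J; src J j = x; X \<in> obj (K x)\<rbrakk> \<Longrightarrow> far (T j) (idn (K x) X) = idn (K (tgt J j)) (fob (T j) X)"
    "\<lbrakk>j \<in> arr J; src J j = x; f \<in> arr (K x); g \<in> arr (K x); src (K x) g = tgt (K x) f\<rbrakk> \<Longrightarrow>
      far (T j) (cmp (K x) g f) = cmp (K (tgt J j)) (far (T j) g) (far (T j) f)"
    for j X f g x
    by (auto simp: is_functorD[OF T])
  note simps = groth_sel groth_simps Js Ks Ts Tid Tcmp hom_def comp_functor_simps id_functor_simps
  show ?thesis
  proof (rule categoryI, goal_cases)
    \<comment> \<open>The guard in the definition of \<open>cmp\<close> is phrased with
      \<open>groth_src\<close> and \<open>groth_tgt\<close>, which agree with the structure maps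
      \<open>src\<close> and \<open>tgt\<close> on arrows; outside the guard the value is
      \<open>undefined\<close>.\<close>
    case (9 g f)
    show ?case
    proof (rule ccontr)
      assume "\<not> ?case"
      then have "g \<in> groth_arr J K T" "f \<in> groth_arr J K T" "groth_src J g = groth_tgt J K f"
        by (auto simp: groth_def split: if_splits)
      with 9 show False by (auto simp: groth_def)
    qed
  next
    case (10 g f)
    then have "f \<in> groth_arr J K T" "g \<in> groth_arr J K T" by (simp_all add: simps)
    with 10(3) show ?case by (auto elim!: groth_arrE simp: simps)
  next
    case (13 f g h)
    then have "f \<in> groth_arr J K T" "g \<in> groth_arr J K T" "h \<in> groth_arr J K T" by (simp_all add: simps)
    with 13(4-) show ?case by (auto elim!: groth_arrE simp: simps category_assoc[OF J] category_assoc[OF K])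
  qed (auto elim!: groth_objE groth_arrE simp: simps, auto simp: groth_def)
qed

lemma small_groth:
  assumes "indexed_cat J K T"
  shows "small_category (groth J K T)"
proof -
  have s: "small (obj J)" "small (arr J)" "\<And>x. x \<in> obj J \<Longrightarrow> small (obj (K x))"
    "\<And>x. x \<in> obj J \<Longrightarrow> small (arr (K x))" and J: "category J"
    using assms by (auto simp: indexed_cat_def small_category_def)
  have "small (\<Union>x\<in>obj J. vpair x ` obj (K x))"
    by (intro small_UN s small_image)
  then have "small (groth_obj J K)"
    by (rule small_subset) (auto simp: groth_obj_def)
  \<comment> \<open>The condition tying the source of the fibre arrow to \<open>fob (T j) X\<close>
    is dropped: a small superset of the arrows suffices.\<close>
  moreover have "small (\<Union>j\<in>arr J. \<Union>X\<in>obj (K (src J j)). garr X j ` arr (K (tgt J j)))"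
    by (intro small_UN s small_image categoryD[OF J])
  then have "small (groth_arr J K T)"
    by (rule small_subset) (auto simp: groth_arr_def)
  ultimately show ?thesis
    using category_groth[OF assms] by (simp add: small_category_def groth_sel)
qed

text \<open>The fibres of a diagram and of its pushforward agree only over \<open>J\<close>;
  elsewhere the two families may differ. Equality of the records survives because every structure
  map consults \<open>K\<close> and \<open>T\<close> only over \<open>J\<close>.\<close>

lemma groth_cong:
  assumes J: "category J" and K: "\<And>x. x \<in> obj J \<Longrightarrow> K x = K' x" and T: "\<And>j. j \<in> arr J \<Longrightarrow> T j = T' j"
  shows "groth J K T = groth J K' T'"
proof -
  note Js = categoryD[OF J]
  have obj: "groth_obj J K = groth_obj J K'"
    by (auto simp: K groth_obj_def)
  have arr: "groth_arr J K T = groth_arr J K' T'"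
    using Js(1,2) by (auto simp: K T groth_arr_def)
  have tgt: "groth_tgt J K a = groth_tgt J K' a" if "a \<in> groth_arr J K' T'" for a
    using that Js(2) by (auto simp: K groth_tgt_def elim!: groth_arrE)
  have idn: "idn (groth J K T) = idn (groth J K' T')"
    by (auto simp: groth_def obj K restrict_def fun_eq_iff elim!: groth_objE)
  have cmp: "cmp (groth J K T) b a = cmp (groth J K' T') b a" for a b
    using Js(2) by (auto simp: groth_def arr tgt K T elim!: groth_arrE)
  have "src (groth J K T) = src (groth J K' T')" "tgt (groth J K T) = tgt (groth J K' T')"
    by (auto simp: groth_def arr tgt restrict_def fun_eq_iff)
  moreover have "cmp (groth J K T) = cmp (groth J K' T')" using cmp by (intro ext)
  moreover have "obj (groth J K T) = obj (groth J K' T')" "arr (groth J K T) = arr (groth J K' T')"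
    by (simp_all add: groth_sel obj arr)
  ultimately show ?thesis using idn by simp
qed

section \<open>The multiplication\<close>

abbreviation dob :: "('u, 'o, 'a) dgm \<Rightarrow> 'u \<Rightarrow> 'o"
  where "dob D x \<equiv> fob (dfun D) x"

abbreviation dar :: "('u, 'o, 'a) dgm \<Rightarrow> 'u \<Rightarrow> 'a"
  where "dar D f \<equiv> far (dfun D) f"

section \<open>Diagrams of diagrams, unpacked fibre by fibre\<close>

lemma functor_DiagD:
  assumes "is_functor J (Diag C) F"
  shows "x \<in> obj J \<Longrightarrow> is_dgm C (fob F x)"
    and "j \<in> arr J \<Longrightarrow> is_dmor C (far F j)"
    and "j \<in> arr J \<Longrightarrow> msrc (far F j) = fob F (src J j)"
    and "j \<in> arr J \<Longrightarrow> mtgt (far F j) = fob F (tgt J j)"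
  using is_functorD[OF assms] by (auto simp: Diag_simps)

lemma is_dmor_DiagD:
  fixes m :: "('u::universe, ('v::universe, 'o, 'a) dgm, ('v, 'o, 'a) dmor) dmor"
  assumes "is_dmor (Diag C) m" and "msrc m = S" and "mtgt m = T"
  shows "x \<in> obj (shape S) \<Longrightarrow> is_dmor C (mnat m x)"
    and "x \<in> obj (shape S) \<Longrightarrow> msrc (mnat m x) = dob S x"
    and "x \<in> obj (shape S) \<Longrightarrow> mtgt (mnat m x) = dob T (fob (mfun m) x)"
  using is_dmorD[OF assms(1)] assms(2,3) by (auto simp: Diag_simps)

text \<open>The data of a diagram of diagrams as rewrite rules: each equation in
  \<open>Diag C\<close> is split into its functor part and its components. The premise
  \<open>src (shape D) j = x\<close> with a free \<open>x\<close> allows fibres over an object that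
  is only provably the source of \<open>j\<close>.\<close>

lemma is_dgm_DiagD:
  fixes D :: "('u::universe, ('v::universe, 'o, 'a) dgm, ('v, 'o, 'a) dmor) dgm"
  assumes D: "is_dgm (Diag C) D"
  shows "x \<in> obj (shape D) \<Longrightarrow> is_dgm C (dob D x)"
    and "x \<in> obj (shape D) \<Longrightarrow> category (shape (dob D x))"
    and "x \<in> obj (shape D) \<Longrightarrow> small_category (shape (dob D x))"
    and "\<lbrakk>x \<in> obj (shape D); X \<in> obj (shape (dob D x))\<rbrakk> \<Longrightarrow> dob (dob D x) X \<in> obj C"
    and "\<lbrakk>x \<in> obj (shape D); f \<in> arr (shape (dob D x))\<rbrakk> \<Longrightarrow> dar (dob D x) f \<in> arr C"
    and "\<lbrakk>x \<in> obj (shape D); f \<in> arr (shape (dob D x))\<rbrakk> \<Longrightarrow>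
      src C (dar (dob D x) f) = dob (dob D x) (src (shape (dob D x)) f)"
    and "\<lbrakk>x \<in> obj (shape D); f \<in> arr (shape (dob D x))\<rbrakk> \<Longrightarrow>
      tgt C (dar (dob D x) f) = dob (dob D x) (tgt (shape (dob D x)) f)"
    and "\<lbrakk>x \<in> obj (shape D); X \<in> obj (shape (dob D x))\<rbrakk> \<Longrightarrow>
      dar (dob D x) (idn (shape (dob D x)) X) = idn C (dob (dob D x) X)"
    and "\<lbrakk>x \<in> obj (shape D); f \<in> arr (shape (dob D x)); g \<in> arr (shape (dob D x));
      src (shape (dob D x)) g = tgt (shape (dob D x)) f\<rbrakk> \<Longrightarrow>
      dar (dob D x) (cmp (shape (dob D x)) g f) = cmp C (dar (dob D x) g) (dar (dob D x) f)"
    and "j \<in> arr (shape D) \<Longrightarrow> is_dmor C (dar D j)"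
    and "\<lbrakk>j \<in> arr (shape D); src (shape D) j = x; X \<in> obj (shape (dob D x))\<rbrakk> \<Longrightarrow>
      fob (mfun (dar D j)) X \<in> obj (shape (dob D (tgt (shape D) j)))"
    and "\<lbrakk>j \<in> arr (shape D); src (shape D) j = x; f \<in> arr (shape (dob D x))\<rbrakk> \<Longrightarrow>
      far (mfun (dar D j)) f \<in> arr (shape (dob D (tgt (shape D) j)))"
    and "\<lbrakk>j \<in> arr (shape D); f \<in> arr (shape (dob D (src (shape D) j)))\<rbrakk> \<Longrightarrow>
      src (shape (dob D (tgt (shape D) j))) (far (mfun (dar D j)) f) =
      fob (mfun (dar D j)) (src (shape (dob D (src (shape D) j))) f)"
    and "\<lbrakk>j \<in> arr (shape D); f \<in> arr (shape (dob D (src (shape D) j)))\<rbrakk> \<Longrightarrow>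
      tgt (shape (dob D (tgt (shape D) j))) (far (mfun (dar D j)) f) =
      fob (mfun (dar D j)) (tgt (shape (dob D (src (shape D) j))) f)"
    and "\<lbrakk>j \<in> arr (shape D); X \<in> obj (shape (dob D (src (shape D) j)))\<rbrakk> \<Longrightarrow> mnat (dar D j) X \<in> arr C"
    and "\<lbrakk>j \<in> arr (shape D); X \<in> obj (shape (dob D (src (shape D) j)))\<rbrakk> \<Longrightarrow>
      src C (mnat (dar D j) X) = dob (dob D (src (shape D) j)) X"
    and "\<lbrakk>j \<in> arr (shape D); X \<in> obj (shape (dob D (src (shape D) j)))\<rbrakk> \<Longrightarrow>
      tgt C (mnat (dar D j) X) = dob (dob D (tgt (shape D) j)) (fob (mfun (dar D j)) X)"
    and "\<lbrakk>j \<in> arr (shape D); f \<in> arr (shape (dob D (src (shape D) j)))\<rbrakk> \<Longrightarrow>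
      cmp C (mnat (dar D j) (tgt (shape (dob D (src (shape D) j))) f)) (dar (dob D (src (shape D) j)) f) =
      cmp C (dar (dob D (tgt (shape D) j)) (far (mfun (dar D j)) f))
        (mnat (dar D j) (src (shape (dob D (src (shape D) j))) f))"
    and "x \<in> obj (shape D) \<Longrightarrow> mfun (dar D (idn (shape D) x)) = id_functor (shape (dob D x))"
    and "\<lbrakk>x \<in> obj (shape D); X \<in> obj (shape (dob D x))\<rbrakk> \<Longrightarrow>
      mnat (dar D (idn (shape D) x)) X = idn C (dob (dob D x) X)"
    and "\<lbrakk>j \<in> arr (shape D); k \<in> arr (shape D); src (shape D) k = tgt (shape D) j\<rbrakk> \<Longrightarrow>
      mfun (dar D (cmp (shape D) k j)) =
      comp_functor (shape (dob D (src (shape D) j))) (mfun (dar D k)) (mfun (dar D j))"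
    and "\<lbrakk>j \<in> arr (shape D); k \<in> arr (shape D); src (shape D) k = tgt (shape D) j;
        X \<in> obj (shape (dob D (src (shape D) j)))\<rbrakk> \<Longrightarrow>
      mnat (dar D (cmp (shape D) k j)) X =
      cmp C (mnat (dar D k) (fob (mfun (dar D j)) X)) (mnat (dar D j) X)"
proof -
  note Ds = is_dgmD[OF D] and F = functor_DiagD[OF is_dgmD(3)[OF D]]
  note Fs = is_functorD[OF is_dgmD(3)[OF D]]
  show 1: "is_dgm C (dob D x)" if "x \<in> obj (shape D)" for x using that by (rule F)
  show "x \<in> obj (shape D) \<Longrightarrow> category (shape (dob D x))"
    "x \<in> obj (shape D) \<Longrightarrow> small_category (shape (dob D x))"
    by (simp_all add: is_dgmD[OF F(1)])
  show 2: "j \<in> arr (shape D) \<Longrightarrow> is_dmor C (dar D j)" for j by (rule F)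
  note E = is_functorD[OF is_dgmD(3)[OF F(1)]]
  show "\<lbrakk>x \<in> obj (shape D); X \<in> obj (shape (dob D x))\<rbrakk> \<Longrightarrow> dob (dob D x) X \<in> obj C"
    "\<lbrakk>x \<in> obj (shape D); f \<in> arr (shape (dob D x))\<rbrakk> \<Longrightarrow> dar (dob D x) f \<in> arr C"
    "\<lbrakk>x \<in> obj (shape D); f \<in> arr (shape (dob D x))\<rbrakk> \<Longrightarrow>
      src C (dar (dob D x) f) = dob (dob D x) (src (shape (dob D x)) f)"
    "\<lbrakk>x \<in> obj (shape D); f \<in> arr (shape (dob D x))\<rbrakk> \<Longrightarrow>
      tgt C (dar (dob D x) f) = dob (dob D x) (tgt (shape (dob D x)) f)"
    "\<lbrakk>x \<in> obj (shape D); X \<in> obj (shape (dob D x))\<rbrakk> \<Longrightarrow>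
      dar (dob D x) (idn (shape (dob D x)) X) = idn C (dob (dob D x) X)"
    "\<lbrakk>x \<in> obj (shape D); f \<in> arr (shape (dob D x)); g \<in> arr (shape (dob D x));
      src (shape (dob D x)) g = tgt (shape (dob D x)) f\<rbrakk> \<Longrightarrow>
      dar (dob D x) (cmp (shape (dob D x)) g f) = cmp C (dar (dob D x) g) (dar (dob D x) f)"
    by (rule E; assumption)+
  show "\<lbrakk>j \<in> arr (shape D); src (shape D) j = x; X \<in> obj (shape (dob D x))\<rbrakk> \<Longrightarrow>
      fob (mfun (dar D j)) X \<in> obj (shape (dob D (tgt (shape D) j)))"
    "\<lbrakk>j \<in> arr (shape D); src (shape D) j = x; f \<in> arr (shape (dob D x))\<rbrakk> \<Longrightarrow>
      far (mfun (dar D j)) f \<in> arr (shape (dob D (tgt (shape D) j)))"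
    "\<lbrakk>j \<in> arr (shape D); f \<in> arr (shape (dob D (src (shape D) j)))\<rbrakk> \<Longrightarrow>
      src (shape (dob D (tgt (shape D) j))) (far (mfun (dar D j)) f) =
      fob (mfun (dar D j)) (src (shape (dob D (src (shape D) j))) f)"
    "\<lbrakk>j \<in> arr (shape D); f \<in> arr (shape (dob D (src (shape D) j)))\<rbrakk> \<Longrightarrow>
      tgt (shape (dob D (tgt (shape D) j))) (far (mfun (dar D j)) f) =
      fob (mfun (dar D j)) (tgt (shape (dob D (src (shape D) j))) f)"
    "\<lbrakk>j \<in> arr (shape D); X \<in> obj (shape (dob D (src (shape D) j)))\<rbrakk> \<Longrightarrow> mnat (dar D j) X \<in> arr C"
    "\<lbrakk>j \<in> arr (shape D); X \<in> obj (shape (dob D (src (shape D) j)))\<rbrakk> \<Longrightarrow>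
      src C (mnat (dar D j) X) = dob (dob D (src (shape D) j)) X"
    "\<lbrakk>j \<in> arr (shape D); X \<in> obj (shape (dob D (src (shape D) j)))\<rbrakk> \<Longrightarrow>
      tgt C (mnat (dar D j) X) = dob (dob D (tgt (shape D) j)) (fob (mfun (dar D j)) X)"
    "\<lbrakk>j \<in> arr (shape D); f \<in> arr (shape (dob D (src (shape D) j)))\<rbrakk> \<Longrightarrow>
      cmp C (mnat (dar D j) (tgt (shape (dob D (src (shape D) j))) f)) (dar (dob D (src (shape D) j)) f) =
      cmp C (dar (dob D (tgt (shape D) j)) (far (mfun (dar D j)) f))
        (mnat (dar D j) (src (shape (dob D (src (shape D) j))) f))"
    using is_dmorD[OF F(2)[of j]] is_functorD[OF is_dmorD(3)[OF F(2)[of j]]] F(3,4)[of j] by auto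
  show "x \<in> obj (shape D) \<Longrightarrow> mfun (dar D (idn (shape D) x)) = id_functor (shape (dob D x))"
    "\<lbrakk>x \<in> obj (shape D); X \<in> obj (shape (dob D x))\<rbrakk> \<Longrightarrow>
      mnat (dar D (idn (shape D) x)) X = idn C (dob (dob D x) X)"
    by (simp_all add: Fs Diag_idn_simps F)
  show "\<lbrakk>j \<in> arr (shape D); k \<in> arr (shape D); src (shape D) k = tgt (shape D) j\<rbrakk> \<Longrightarrow>
      mfun (dar D (cmp (shape D) k j)) =
      comp_functor (shape (dob D (src (shape D) j))) (mfun (dar D k)) (mfun (dar D j))"
    "\<lbrakk>j \<in> arr (shape D); k \<in> arr (shape D); src (shape D) k = tgt (shape D) j;
        X \<in> obj (shape (dob D (src (shape D) j)))\<rbrakk> \<Longrightarrow>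
      mnat (dar D (cmp (shape D) k j)) X =
      cmp C (mnat (dar D k) (fob (mfun (dar D j)) X)) (mnat (dar D j) X)"
    by (simp_all add: Fs Diag_cmp_simps F)
qed

section \<open>The multiplication on diagrams\<close>

lemma indexed_cat_mu:
  assumes D: "is_dgm (Diag C) D"
  shows "indexed_cat (shape D) (\<lambda>j. shape (dob D j)) (\<lambda>j. mfun (dar D j))"
  using is_dgmD[OF D] is_dgm_DiagD[OF D] is_dmorD(3)[OF functor_DiagD(2)[OF is_dgmD(3)[OF D]]]
  by (simp add: indexed_cat_def functor_DiagD[OF is_dgmD(3)[OF D]])

lemma mu_shape_sel:
  "obj (mu_shape D) = groth_obj (shape D) (\<lambda>j. shape (dob D j))"
  "arr (mu_shape D) = groth_arr (shape D) (\<lambda>j. shape (dob D j)) (\<lambda>j. mfun (dar D j))"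
  by (simp_all add: mu_shape_def groth_sel)

lemma mu_shape_simps:
  fixes D :: "('u::universe, ('u, 'o, 'a) dgm, ('u, 'o, 'a) dmor) dgm"
  shows "garr X j f \<in> arr (mu_shape D) \<Longrightarrow> src (mu_shape D) (garr X j f) = vpair (src (shape D) j) X"
  "garr X j f \<in> arr (mu_shape D) \<Longrightarrow>
    tgt (mu_shape D) (garr X j f) = vpair (tgt (shape D) j) (tgt (shape (dob D (tgt (shape D) j))) f)"
  "vpair x X \<in> obj (mu_shape D) \<Longrightarrow>
    idn (mu_shape D) (vpair x X) = garr X (idn (shape D) x) (idn (shape (dob D x)) X)"
  "garr X' j' f' \<in> arr (mu_shape D) \<Longrightarrow> garr X j f \<in> arr (mu_shape D) \<Longrightarrow>
    src (shape D) j' = tgt (shape D) j \<Longrightarrow> X' = tgt (shape (dob D (tgt (shape D) j))) f \<Longrightarrow>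
    cmp (mu_shape D) (garr X' j' f') (garr X j f) =
      garr X (cmp (shape D) j' j) (cmp (shape (dob D (tgt (shape D) j'))) f' (far (mfun (dar D j')) f))"
  by (simp_all add: mu_shape_sel)
     (simp_all add: mu_shape_def groth_simps)

lemma mu_dgm_simps:
  fixes D :: "('u::universe, ('u, 'o, 'a) dgm, ('u, 'o, 'a) dmor) dgm"
  shows "shape (mu_dgm C D) = mu_shape D"
    and "vpair x X \<in> obj (mu_shape D) \<Longrightarrow> dob (mu_dgm C D) (vpair x X) = dob (dob D x) X"
    and "garr X j f \<in> arr (mu_shape D) \<Longrightarrow> dar (mu_dgm C D) (garr X j f) =
      cmp C (dar (dob D (tgt (shape D) j)) f) (mnat (dar D j) X)"
    and "fob (dfun (mu_dgm C D)) \<in> extensional (obj (mu_shape D))"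
    and "far (dfun (mu_dgm C D)) \<in> extensional (arr (mu_shape D))"
  by (simp_all add: mu_dgm_def)

lemma is_dgm_mu:
  fixes D :: "('u::universe, ('u, 'o, 'a) dgm, ('u, 'o, 'a) dmor) dgm"
  assumes D: "is_dgm (Diag C) D" and C: "category C"
  shows "is_dgm C (mu_dgm C D)"
  unfolding is_dgm_def mu_dgm_simps(1)
proof
  note Cs = categoryD[OF C] and Ds = is_dgm_DiagD[OF D] and Js = categoryD[OF is_dgmD(2)[OF D]]
  note Ks = categoryD[OF Ds(2)]
  note simps = mu_shape_sel mu_shape_simps mu_dgm_simps Cs Ds Js Ks comp_functor_simps id_functor_simps
  show sm: "small_category (mu_shape D)"
    unfolding mu_shape_def by (rule small_groth[OF indexed_cat_mu[OF D]])
  show "is_functor (mu_shape D) C (dfun (mu_dgm C D))"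
  proof (rule is_functorI, goal_cases)
    case 1 then show ?case using sm by (simp add: small_category_def)
  next
    case (10 f g)
    then obtain X j a X' j' a' where f: "f = garr X j a" "g = garr X' j' a'"
      by (auto simp: simps elim!: groth_arrE)
    have a: "garr X j a \<in> arr (mu_shape D)" "garr X' j' a' \<in> arr (mu_shape D)"
      using 10 f by simp_all
    have b: "j \<in> arr (shape D)" "j' \<in> arr (shape D)" "X \<in> obj (shape (dob D (src (shape D) j)))"
      "a \<in> arr (shape (dob D (tgt (shape D) j)))" "a' \<in> arr (shape (dob D (tgt (shape D) j')))"
      "src (shape (dob D (tgt (shape D) j))) a = fob (mfun (dar D j)) X"
      "src (shape (dob D (tgt (shape D) j'))) a' = fob (mfun (dar D j')) X'"
      using a by (simp_all add: simps)
    have c: "src (shape D) j' = tgt (shape D) j" "X' = tgt (shape (dob D (tgt (shape D) j))) a"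
      using 10(3) a by (simp_all add: f simps)
    let ?E = "dob D (tgt (shape D) j)" and ?E' = "dob D (tgt (shape D) j')"
    \<comment> \<open>In the image of a composite the second horizontal component stands before the
      image of the first fibre arrow. Naturality of \<open>mnat (dar D j')\<close> at
      \<open>a\<close> exchanges the two, which separates the contributions of \<open>f\<close> and
      \<open>g\<close>.\<close>
    have nat: "cmp C (dar ?E' (far (mfun (dar D j')) a)) (mnat (dar D j') (fob (mfun (dar D j)) X)) =
       cmp C (mnat (dar D j') X') (dar ?E a)"
      using Ds(18)[of j' a] b c by simp
    have "dar (mu_dgm C D) (cmp (mu_shape D) g f) =
      cmp C (cmp C (dar ?E' a') (dar ?E' (far (mfun (dar D j')) a)))
        (cmp C (mnat (dar D j') (fob (mfun (dar D j)) X)) (mnat (dar D j) X))"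
      using b by (simp add: f simps c)
    also have "\<dots> = cmp C (dar ?E' a') (cmp C (cmp C (dar ?E' (far (mfun (dar D j')) a))
        (mnat (dar D j') (fob (mfun (dar D j)) X))) (mnat (dar D j) X))"
      using b c by (simp add: simps category_assoc[OF C])
    also have "\<dots> = cmp C (cmp C (dar ?E' a') (mnat (dar D j') X')) (cmp C (dar ?E a) (mnat (dar D j) X))"
      unfolding nat using b c by (simp add: simps category_assoc[OF C])
    also have "\<dots> = cmp C (dar (mu_dgm C D) g) (dar (mu_dgm C D) f)"
      using b by (simp add: f simps c)
    finally show ?case .
  qed (use C in \<open>auto simp: simps mu_dgm_simps(4,5)[unfolded mu_shape_sel] elim!: groth_objE groth_arrE\<close>)
qed

text \<open>The naturality square of \<open>m\<close> at \<open>j\<close> is one equation between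
  morphisms of \<open>Diag C\<close>. Applying its functor part to objects and to arrows, and
  reading off components, turns it into three equations in the fibres and in
  \<open>C\<close>.\<close>

lemma is_dmor_Diag_natural:
  fixes m :: "('u::universe, ('v::universe, 'o, 'a) dgm, ('v, 'o, 'a) dmor) dmor"
  assumes m: "is_dmor (Diag C) m" and S: "msrc m = S" and T: "mtgt m = T"
    and j: "j \<in> arr (shape S)" and x: "src (shape S) j = x"
  defines "y \<equiv> tgt (shape S) j"
  shows "X \<in> obj (shape (dob S x)) \<Longrightarrow>
      fob (mfun (dar T (far (mfun m) j))) (fob (mfun (mnat m x)) X) =
      fob (mfun (mnat m y)) (fob (mfun (dar S j)) X)"
    and "f \<in> arr (shape (dob S x)) \<Longrightarrow>
      far (mfun (dar T (far (mfun m) j))) (far (mfun (mnat m x)) f) =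
      far (mfun (mnat m y)) (far (mfun (dar S j)) f)"
    and "X \<in> obj (shape (dob S x)) \<Longrightarrow>
      cmp C (mnat (dar T (far (mfun m) j)) (fob (mfun (mnat m x)) X)) (mnat (mnat m x) X) =
      cmp C (mnat (mnat m y) (fob (mfun (dar S j)) X)) (mnat (dar S j) X)"
proof -
  note ms = is_dmorD[OF m, unfolded S T] and mm = is_dmor_DiagD[OF m S T]
  note FS = functor_DiagD[OF is_dgmD(3)[OF ms(1)]] and FT = functor_DiagD[OF is_dgmD(3)[OF ms(2)]]
  note R = is_functorD[OF ms(3)] and Js = categoryD[OF is_dgmD(2)[OF ms(1)]]
  have a: "is_dmor C (dar S j)" "is_dmor C (mnat m y)" "msrc (mnat m y) = mtgt (dar S j)"
    and b: "is_dmor C (mnat m x)" "is_dmor C (dar T (far (mfun m) j))"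
      "msrc (dar T (far (mfun m) j)) = mtgt (mnat m x)"
    and c: "msrc (dar S j) = dob S x" "msrc (mnat m x) = dob S x"
    using j by (simp_all add: x[symmetric] y_def mm Js FS FT R)
  have eq: "cmp (Diag C) (dar T (far (mfun m) j)) (mnat m x) = cmp (Diag C) (mnat m y) (dar S j)"
    using ms(8)[OF j] by (simp add: x y_def)
  note p = Diag_cmp_simps[OF a] and q = Diag_cmp_simps[OF b]
  show "X \<in> obj (shape (dob S x)) \<Longrightarrow>
      fob (mfun (dar T (far (mfun m) j))) (fob (mfun (mnat m x)) X) =
      fob (mfun (mnat m y)) (fob (mfun (dar S j)) X)"
    using arg_cong[OF eq, of "\<lambda>n. fob (mfun n) X"] by (simp add: p q c comp_functor_simps)
  show "f \<in> arr (shape (dob S x)) \<Longrightarrow>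
      far (mfun (dar T (far (mfun m) j))) (far (mfun (mnat m x)) f) =
      far (mfun (mnat m y)) (far (mfun (dar S j)) f)"
    using arg_cong[OF eq, of "\<lambda>n. far (mfun n) f"] by (simp add: p q c comp_functor_simps)
  show "X \<in> obj (shape (dob S x)) \<Longrightarrow>
      cmp C (mnat (dar T (far (mfun m) j)) (fob (mfun (mnat m x)) X)) (mnat (mnat m x) X) =
      cmp C (mnat (mnat m y) (fob (mfun (dar S j)) X)) (mnat (dar S j) X)"
    using arg_cong[OF eq, of "\<lambda>n. mnat n X"] by (simp add: p q c)
qed

lemma is_dmor_Diag_fibre:
  fixes m :: "('u::universe, ('v::universe, 'o, 'a) dgm, ('v, 'o, 'a) dmor) dmor"
  assumes m: "is_dmor (Diag C) m" and S: "msrc m = S" and T: "mtgt m = T" and x: "x \<in> obj (shape S)"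
  shows "X \<in> obj (shape (dob S x)) \<Longrightarrow>
      fob (mfun (mnat m x)) X \<in> obj (shape (dob T (fob (mfun m) x)))"
    and "f \<in> arr (shape (dob S x)) \<Longrightarrow>
      far (mfun (mnat m x)) f \<in> arr (shape (dob T (fob (mfun m) x)))"
    and "f \<in> arr (shape (dob S x)) \<Longrightarrow>
      src (shape (dob T (fob (mfun m) x))) (far (mfun (mnat m x)) f) =
      fob (mfun (mnat m x)) (src (shape (dob S x)) f)"
    and "f \<in> arr (shape (dob S x)) \<Longrightarrow>
      tgt (shape (dob T (fob (mfun m) x))) (far (mfun (mnat m x)) f) =
      fob (mfun (mnat m x)) (tgt (shape (dob S x)) f)"
    and "X \<in> obj (shape (dob S x)) \<Longrightarrow>
      far (mfun (mnat m x)) (idn (shape (dob S x)) X) =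
      idn (shape (dob T (fob (mfun m) x))) (fob (mfun (mnat m x)) X)"
    and "\<lbrakk>f \<in> arr (shape (dob S x)); g \<in> arr (shape (dob S x));
        src (shape (dob S x)) g = tgt (shape (dob S x)) f\<rbrakk> \<Longrightarrow>
      far (mfun (mnat m x)) (cmp (shape (dob S x)) g f) =
      cmp (shape (dob T (fob (mfun m) x))) (far (mfun (mnat m x)) g) (far (mfun (mnat m x)) f)"
    and "X \<in> obj (shape (dob S x)) \<Longrightarrow> mnat (mnat m x) X \<in> arr C"
    and "X \<in> obj (shape (dob S x)) \<Longrightarrow> src C (mnat (mnat m x) X) = dob (dob S x) X"
    and "X \<in> obj (shape (dob S x)) \<Longrightarrow> tgt C (mnat (mnat m x) X) =
      dob (dob T (fob (mfun m) x)) (fob (mfun (mnat m x)) X)"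
    and "f \<in> arr (shape (dob S x)) \<Longrightarrow>
      cmp C (mnat (mnat m x) (tgt (shape (dob S x)) f)) (dar (dob S x) f) =
      cmp C (dar (dob T (fob (mfun m) x)) (far (mfun (mnat m x)) f))
        (mnat (mnat m x) (src (shape (dob S x)) f))"
  using is_dmorD[OF is_dmor_DiagD(1)[OF m S T x]] is_dmor_DiagD(2,3)[OF m S T x]
    is_functorD[OF is_dmorD(3)[OF is_dmor_DiagD(1)[OF m S T x]]]
  by auto

lemma mu_dmor_simps:
  fixes m :: "('u::universe, ('u, 'o, 'a) dgm, ('u, 'o, 'a) dmor) dmor"
  shows "msrc (mu_dmor C m) = mu_dgm C (msrc m)" "mtgt (mu_dmor C m) = mu_dgm C (mtgt m)"
    and "vpair x X \<in> obj (mu_shape (msrc m)) \<Longrightarrow> fob (mfun (mu_dmor C m)) (vpair x X) =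
      vpair (fob (mfun m) x) (fob (mfun (mnat m x)) X)"
    and "garr X j f \<in> arr (mu_shape (msrc m)) \<Longrightarrow> far (mfun (mu_dmor C m)) (garr X j f) =
      garr (fob (mfun (mnat m (src (shape (msrc m)) j))) X) (far (mfun m) j)
        (far (mfun (mnat m (tgt (shape (msrc m)) j))) f)"
    and "vpair x X \<in> obj (mu_shape (msrc m)) \<Longrightarrow> mnat (mu_dmor C m) (vpair x X) = mnat (mnat m x) X"
    and "fob (mfun (mu_dmor C m)) \<in> extensional (obj (mu_shape (msrc m)))"
    and "far (mfun (mu_dmor C m)) \<in> extensional (arr (mu_shape (msrc m)))"
    and "mnat (mu_dmor C m) \<in> extensional (obj (mu_shape (msrc m)))"
  by (simp_all add: mu_dmor_def)

lemma is_dmor_mu: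
  fixes m :: "('u::universe, ('u, 'o, 'a) dgm, ('u, 'o, 'a) dmor) dmor"
  assumes m: "is_dmor (Diag C) m" and C: "category C"
  shows "is_dmor C (mu_dmor C m)"
proof -
  note ms = is_dmorD[OF m] and mm = is_dmor_DiagD[OF m refl refl] and mf = is_dmor_Diag_fibre[OF m refl refl]
  note mn = is_dmor_Diag_natural[OF m refl refl]
  note R = is_functorD[OF ms(3)] and Js = categoryD[OF is_dgmD(2)[OF ms(1)]]
    and J's = categoryD[OF is_dgmD(2)[OF ms(2)]]
  note Cs = categoryD[OF C] and Ds = is_dgm_DiagD[OF ms(1)] and D's = is_dgm_DiagD[OF ms(2)]
  note Ks = categoryD[OF Ds(2)] and K's = categoryD[OF D's(2)]
  note dS = is_dgm_mu[OF ms(1) C] and dT = is_dgm_mu[OF ms(2) C]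
  note simps = mu_shape_sel mu_shape_simps mu_dgm_simps mu_dmor_simps Cs Ds D's Js J's Ks K's R mf(1-9)
    comp_functor_simps id_functor_simps
  show ?thesis
  proof (rule is_dmorI, unfold mu_dmor_simps(1,2) mu_dgm_simps(1))
    show "is_dgm C (mu_dgm C (msrc m))" "is_dgm C (mu_dgm C (mtgt m))" by fact+
    show "is_functor (mu_shape (msrc m)) (mu_shape (mtgt m)) (mfun (mu_dmor C m))"
    proof (rule is_functorI, goal_cases)
      case 1 then show ?case using is_dgmD(2)[OF dS] by (simp add: mu_dgm_simps)
    next
      case 2 then show ?case using is_dgmD(2)[OF dT] by (simp add: mu_dgm_simps)
    next
      case (10 f g)
      then have "f \<in> groth_arr (shape (msrc m)) (\<lambda>j. shape (dob (msrc m) j)) (\<lambda>j. mfun (dar (msrc m) j))"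
        "g \<in> groth_arr (shape (msrc m)) (\<lambda>j. shape (dob (msrc m) j)) (\<lambda>j. mfun (dar (msrc m) j))"
        by (simp_all add: simps)
      with 10(3) show ?case by (auto simp: simps mn elim!: groth_arrE)
    qed (auto simp: simps mn mu_dmor_simps(6,7)[unfolded mu_shape_sel] elim!: groth_objE groth_arrE)
    show "mnat (mu_dmor C m) \<in> extensional (obj (mu_shape (msrc m)))"
      by (rule mu_dmor_simps)
    show "mnat (mu_dmor C m) p \<in> hom C (dob (mu_dgm C (msrc m)) p)
        (dob (mu_dgm C (mtgt m)) (fob (mfun (mu_dmor C m)) p))"
      if "p \<in> obj (mu_shape (msrc m))" for p
      using that by (auto simp: simps hom_def elim!: groth_objE)
    show "cmp C (mnat (mu_dmor C m) (tgt (mu_shape (msrc m)) f)) (dar (mu_dgm C (msrc m)) f) =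
      cmp C (dar (mu_dgm C (mtgt m)) (far (mfun (mu_dmor C m)) f))
        (mnat (mu_dmor C m) (src (mu_shape (msrc m)) f))"
      if f_arr: "f \<in> arr (mu_shape (msrc m))" for f
    proof -
      obtain X j a where f: "f = garr X j a" using f_arr by (auto simp: simps elim!: groth_arrE)
      have b: "j \<in> arr (shape (msrc m))" "X \<in> obj (shape (dob (msrc m) (src (shape (msrc m)) j)))"
        "a \<in> arr (shape (dob (msrc m) (tgt (shape (msrc m)) j)))"
        "src (shape (dob (msrc m) (tgt (shape (msrc m)) j))) a = fob (mfun (dar (msrc m) j)) X"
        using f_arr by (simp_all add: simps f)
      let ?x = "src (shape (msrc m)) j" and ?y = "tgt (shape (msrc m)) j"
      let ?X' = "tgt (shape (dob (msrc m) ?y)) a"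
      let ?X'' = "fob (mfun (dar (msrc m) j)) X"
      let ?E = "dar (dob (mtgt m) (fob (mfun m) ?y)) (far (mfun (mnat m ?y)) a)"
      have "cmp C (mnat (mu_dmor C m) (tgt (mu_shape (msrc m)) f)) (dar (mu_dgm C (msrc m)) f) =
        cmp C (cmp C (mnat (mnat m ?y) ?X') (dar (dob (msrc m) ?y) a)) (mnat (dar (msrc m) j) X)"
        using b by (simp add: f simps category_assoc[OF C])
      \<comment> \<open>The vertical half of the square: naturality of
        \<open>mnat (mnat m ?y)\<close> at the fibre arrow \<open>a\<close>.\<close>
      also have "\<dots> = cmp C (cmp C ?E (mnat (mnat m ?y) ?X'')) (mnat (dar (msrc m) j) X)"
        using mf(10)[of ?y a] b by (simp add: simps)
      also have "\<dots> = cmp C ?E (cmp C (mnat (mnat m ?y) ?X'') (mnat (dar (msrc m) j) X))"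
        using b by (simp add: simps category_assoc[OF C])
      \<comment> \<open>The horizontal half: the component at \<open>X\<close> of the naturality
        square of \<open>m\<close> at \<open>j\<close>.\<close>
      also have "\<dots> = cmp C ?E (cmp C (mnat (dar (mtgt m) (far (mfun m) j)) (fob (mfun (mnat m ?x)) X))
          (mnat (mnat m ?x) X))"
        using mn(3)[OF b(1) refl b(2)] by simp
      also have "\<dots> = cmp C (dar (mu_dgm C (mtgt m)) (far (mfun (mu_dmor C m)) f))
        (mnat (mu_dmor C m) (src (mu_shape (msrc m)) f))"
        using b by (simp add: f simps mn category_assoc[OF C])
      finally show ?thesis .
    qed
  qed
qed

lemma mu_dmor_idn:
  fixes D :: "('u::universe, ('u, 'o, 'a) dgm, ('u, 'o, 'a) dmor) dgm"
  assumes D: "is_dgm (Diag C) D" and C: "category C"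
  shows "mu_dmor C (idn (Diag (Diag C)) D) = idn (Diag C) (mu_dgm C D)"
proof -
  note Ds = is_dgm_DiagD[OF D] and I = Diag_idn_simps[OF D] and J = Diag_idn_simps[OF is_dgm_mu[OF assms]]
  note Js = categoryD[OF is_dgmD(2)[OF D]]
  note simps = mu_dgm_simps mu_dmor_simps id_functor_simps I J Ds Js Diag_idn_simps[OF Ds(1)]
  show ?thesis
  proof (rule dmor_eqI[of _ _ "obj (mu_shape D)"])
    show "mfun (mu_dmor C (idn (Diag (Diag C)) D)) = mfun (idn (Diag C) (mu_dgm C D))"
      unfolding J mu_dgm_simps(1)
      using mu_dmor_simps(6,7)[of C "idn (Diag (Diag C)) D", unfolded I] id_functor_simps(3,4)[of "mu_shape D"]
      by (intro functor_eqI[of _ "obj (mu_shape D)" _ "arr (mu_shape D)"])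
        (auto simp: simps mu_dmor_simps(6,7) mu_shape_sel elim!: groth_objE groth_arrE)
  qed (use mu_dmor_simps(8)[of C "idn (Diag (Diag C)) D", unfolded I] J(5) in
     \<open>auto simp: simps mu_shape_sel elim!: groth_objE\<close>)
qed

lemma mu_dmor_cmp:
  fixes m :: "('u::universe, ('u, 'o, 'a) dgm, ('u, 'o, 'a) dmor) dmor"
  assumes m: "is_dmor (Diag C) m" and n: "is_dmor (Diag C) n" and mn: "msrc n = mtgt m" and C: "category C"
  shows "mu_dmor C (cmp (Diag (Diag C)) n m) = cmp (Diag C) (mu_dmor C n) (mu_dmor C m)"
proof -
  note ms = is_dmorD[OF m] and mm = is_dmor_DiagD[OF m refl refl] and mf = is_dmor_Diag_fibre[OF m refl refl]
  note ns = is_dmorD[OF n, unfolded mn] and nm = is_dmor_DiagD[OF n mn refl]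
  note Js = categoryD[OF is_dgmD(2)[OF ms(1)]] and R = is_functorD[OF ms(3)]
  note c = Diag_cmp_simps[OF m n mn]
  have d: "msrc (mu_dmor C n) = mtgt (mu_dmor C m)" by (simp add: mu_dmor_simps mn)
  note e = Diag_cmp_simps[OF is_dmor_mu[OF m C] is_dmor_mu[OF n C] d]
  have g: "x \<in> obj (shape (msrc m)) \<Longrightarrow>
    mnat (cmp (Diag (Diag C)) n m) x = cmp (Diag C) (mnat n (fob (mfun m) x)) (mnat m x)" for x
    by (simp add: c)
  note h = Diag_cmp_simps[OF mm(1) nm(1), simplified nm mm R]
  have sh: "shape (mu_dgm C (msrc m)) = mu_shape (msrc m)" by (simp add: mu_dgm_simps)
  note simps = mu_shape_sel mu_dgm_simps mu_dmor_simps comp_functor_simps Js R mm nm mf mn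
  show ?thesis
  proof (rule dmor_eqI[of _ _ "obj (mu_shape (msrc m))"])
    show "mfun (mu_dmor C (cmp (Diag (Diag C)) n m)) = mfun (cmp (Diag C) (mu_dmor C n) (mu_dmor C m))"
      unfolding e mu_dmor_simps(1) sh
      using mu_dmor_simps(6,7)[of C "cmp (Diag (Diag C)) n m", unfolded c]
        comp_functor_simps(3,4)[of "mu_shape (msrc m)" "mfun (mu_dmor C n)" "mfun (mu_dmor C m)"]
      by (intro functor_eqI[of _ "obj (mu_shape (msrc m))" _ "arr (mu_shape (msrc m))"])
        (auto simp: simps c h is_dmor_Diag_natural[OF m refl refl] elim!: groth_objE groth_arrE)
  qed (use mu_dmor_simps(8)[of C "cmp (Diag (Diag C)) n m", unfolded c] e(5) in
     \<open>auto simp: simps c e h elim!: groth_objE\<close>)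
qed

lemma is_functor_mu:
  assumes C: "category C"
  shows "is_functor (Diag (Diag C)) (Diag C) (mu C)"
  by (rule is_functorI)
    (auto simp: mu_def category_Diag C Diag_simps is_dgm_mu is_dmor_mu mu_dmor_simps mu_dmor_idn mu_dmor_cmp
      is_dmorD is_dmor_idn is_dmor_cmp)

section \<open>Action on functors, unit, unitor and associator\<close>

lemma push_dgm_simps:
  "shape (push_dgm F D) = shape D"
  "x \<in> obj (shape D) \<Longrightarrow> dob (push_dgm F D) x = fob F (dob D x)"
  "f \<in> arr (shape D) \<Longrightarrow> dar (push_dgm F D) f = far F (dar D f)"
  "fob (dfun (push_dgm F D)) \<in> extensional (obj (shape D))"
  "far (dfun (push_dgm F D)) \<in> extensional (arr (shape D))"
  by (simp_all add: push_dgm_def comp_functor_simps)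

lemma is_dgm_push:
  assumes "is_functor C B F" "is_dgm C D"
  shows "is_dgm B (push_dgm F D)"
  using assms(2) is_functor_comp[OF is_dgmD(3)[OF assms(2)] assms(1)]
  by (simp add: is_dgm_def push_dgm_def)

lemma push_dgm_id:
  assumes "is_dgm C D"
  shows "push_dgm (id_functor C) D = D"
  by (rule dgm_eqI) (simp_all add: push_dgm_def comp_functor_id_left[OF is_dgmD(3)[OF assms]])

lemma push_dgm_comp:
  assumes "is_dgm C D"
  shows "push_dgm (comp_functor C G F) D = push_dgm G (push_dgm F D)"
  by (rule dgm_eqI) (simp_all add: push_dgm_def comp_functor_assoc[OF is_dgmD(3)[OF assms]])

lemma star_simps:
  "is_dgm C D \<Longrightarrow> fob (star C F) D = push_dgm F D"
  "is_dmor C m \<Longrightarrow> msrc (far (star C F) m) = push_dgm F (msrc m)"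
  "is_dmor C m \<Longrightarrow> mtgt (far (star C F) m) = push_dgm F (mtgt m)"
  "is_dmor C m \<Longrightarrow> mfun (far (star C F) m) = mfun m"
  "is_dmor C m \<Longrightarrow> x \<in> obj (shape (msrc m)) \<Longrightarrow> mnat (far (star C F) m) x = far F (mnat m x)"
  "is_dmor C m \<Longrightarrow> mnat (far (star C F) m) \<in> extensional (obj (shape (msrc m)))"
  "fob (star C F) \<in> extensional (obj (Diag C))"
  "far (star C F) \<in> extensional (arr (Diag C))"
  by (simp_all add: star_def Diag_simps whisker_left_def compose_def)

lemma is_dmor_star:
  assumes F: "is_functor C B F" and m: "is_dmor C m"
  shows "is_dmor B (far (star C F) m)"
proof -
  note ms = is_dmorD[OF m] and Js = categoryD[OF is_dgmD(2)[OF is_dmorD(1)[OF m]]]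
  note Fs = is_functorD[OF F] and R = is_functorD[OF ms(3)]
  note S = is_functorD[OF is_dgmD(3)[OF ms(1)]] and T = is_functorD[OF is_dgmD(3)[OF ms(2)]]
  show ?thesis
  proof (rule is_dmorI, unfold star_simps(2-4)[OF m] push_dgm_simps(1))
    fix f assume f: "f \<in> arr (shape (msrc m))"
    show "cmp B (mnat (far (star C F) m) (tgt (shape (msrc m)) f)) (dar (push_dgm F (msrc m)) f) =
      cmp B (dar (push_dgm F (mtgt m)) (far (mfun m) f)) (mnat (far (star C F) m) (src (shape (msrc m)) f))"
      using arg_cong[OF ms(8)[OF f], of "far F"] f
      by (simp add: star_simps m push_dgm_simps Js ms(1-7) R Fs S T)
  qed (use ms in \<open>auto simp: star_simps m push_dgm_simps is_dgm_push[OF F] hom_def Fs R\<close>)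
qed

lemma is_functor_star:
  assumes F: "is_functor C B F"
  shows "is_functor (Diag C) (Diag B) (star C F)"
proof -
  note C = functor_category(1)[OF F] and B = functor_category(2)[OF F] and Fs = is_functorD[OF F]
  show ?thesis
  proof (rule is_functorI, goal_cases)
    case (9 D)
    then have D: "is_dgm C D" by (simp add: Diag_simps)
    note I = Diag_idn_simps[OF D] Diag_idn_simps[OF is_dgm_push[OF F D]]
    show ?case
      by (rule dmor_eqI[of _ _ "obj (shape D)"])
        (use I D star_simps(6)[OF is_dmor_idn[OF D]] in
          \<open>simp_all add: star_simps is_dmor_idn push_dgm_simps Fs is_functorD[OF is_dgmD(3)[OF D]]\<close>)
  next
    case (10 m n)
    then have m: "is_dmor C m" and n: "is_dmor C n" and mn: "msrc n = mtgt m" by (auto simp: Diag_simps)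
    have mn': "msrc (far (star C F) n) = mtgt (far (star C F) m)" by (simp add: star_simps m n mn)
    note I = Diag_cmp_simps[OF m n mn] Diag_cmp_simps[OF is_dmor_star[OF F m] is_dmor_star[OF F n] mn']
    note ms = is_dmorD[OF m] and ns = is_dmorD[OF n, unfolded mn]
    note R = is_functorD[OF ms(3)]
    show ?case
      by (rule dmor_eqI[of _ _ "obj (shape (msrc m))"])
        (use I star_simps(6)[OF is_dmor_cmp[OF m n mn]] in
          \<open>simp_all add: star_simps is_dmor_cmp m n mn push_dgm_simps Fs ms ns R\<close>)
  qed (auto simp: Diag_simps category_Diag C B star_simps star_simps(7,8)[unfolded Diag_simps] is_dgm_push[OF F] is_dmor_star[OF F] is_dmorD)
qed

lemma nat_star_simps:
  "is_dgm C D \<Longrightarrow> msrc (nat_star C F G \<alpha> D) = push_dgm F D"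
  "is_dgm C D \<Longrightarrow> mtgt (nat_star C F G \<alpha> D) = push_dgm G D"
  "is_dgm C D \<Longrightarrow> mfun (nat_star C F G \<alpha> D) = id_functor (shape D)"
  "is_dgm C D \<Longrightarrow> x \<in> obj (shape D) \<Longrightarrow> mnat (nat_star C F G \<alpha> D) x = \<alpha> (dob D x)"
  "is_dgm C D \<Longrightarrow> mnat (nat_star C F G \<alpha> D) \<in> extensional (obj (shape D))"
  by (simp_all add: nat_star_def Diag_simps whisker_right_def compose_def)

lemma is_dmor_nat_star:
  assumes a: "is_nat C B F G \<alpha>" and D: "is_dgm C D"
  shows "is_dmor B (nat_star C F G \<alpha> D)"
proof -
  note n = is_natD[OF a] and F = is_nat_functors(1,2)[OF a]
  note Ds = is_functorD[OF is_dgmD(3)[OF D]] and Js = categoryD[OF is_dgmD(2)[OF D]]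
  have "cmp B (\<alpha> (dob D (tgt (shape D) f))) (far F (dar D f)) =
    cmp B (far G (dar D f)) (\<alpha> (dob D (src (shape D) f)))" if "f \<in> arr (shape D)" for f
    using n(4)[of "dar D f"] that by (simp add: Ds)
  then show ?thesis
    by (intro is_dmorI)
      (use D in \<open>simp_all add: nat_star_simps is_dgm_push[OF F(1)] is_dgm_push[OF F(2)] is_functor_id is_dgmD[OF D]
        push_dgm_simps n Ds Js hom_def id_functor_simps\<close>)
qed

section \<open>The point category and the unit\<close>

lemma one_simps [simp]: "obj one = {pt}" "arr one = {pt}" "src one pt = pt" "tgt one pt = pt"
  "idn one pt = pt" "cmp one pt pt = pt"
  by (simp_all add: one_def)

lemma category_one: "category one"
  by (rule categoryI) (auto simp: one_def hom_def)

lemma small_one: "small_category one"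
  by (simp add: small_category_def category_one small_singleton)

lemma point_dgm_simps:
  "shape (point_dgm C x) = one" "dob (point_dgm C x) pt = x" "dar (point_dgm C x) pt = idn C x"
  by (simp_all add: point_dgm_def const_functor_def)

lemma is_dgm_point:
  assumes "category C" "x \<in> obj C"
  shows "is_dgm C (point_dgm C x)"
  using is_functor_const[OF category_one assms] by (simp add: is_dgm_def point_dgm_def small_one)

lemma eta_simps:
  "x \<in> obj C \<Longrightarrow> fob (eta C) x = point_dgm C x"
  "f \<in> arr C \<Longrightarrow> msrc (far (eta C) f) = point_dgm C (src C f)"
  "f \<in> arr C \<Longrightarrow> mtgt (far (eta C) f) = point_dgm C (tgt C f)"
  "f \<in> arr C \<Longrightarrow> mfun (far (eta C) f) = id_functor one"
  "f \<in> arr C \<Longrightarrow> mnat (far (eta C) f) pt = f"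
  "f \<in> arr C \<Longrightarrow> mnat (far (eta C) f) \<in> extensional {pt}"
  "fob (eta C) \<in> extensional (obj C)"
  "far (eta C) \<in> extensional (arr C)"
  by (simp_all add: eta_def)

lemma is_dmor_eta:
  assumes C: "category C" and f: "f \<in> arr C"
  shows "is_dmor C (far (eta C) f)"
  by (rule is_dmorI)
    (use f in \<open>auto simp: eta_simps is_dgm_point[OF C] categoryD[OF C] point_dgm_simps is_functor_id category_one
      hom_def id_functor_simps\<close>)

lemma is_functor_eta:
  fixes C :: "('o, 'a) cat"
  assumes C: "category C"
  shows "is_functor C (Diag C :: (('u::universe, 'o, 'a) dgm, _) cat) (eta C)"
proof -
  note Cs = categoryD[OF C]
  show ?thesis
  proof (rule is_functorI, goal_cases)
    case (9 x)
    then have "is_dgm C (point_dgm C x :: ('u, 'o, 'a) dgm)" by (simp add: is_dgm_point C)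
    with 9 show ?case
      by (intro dmor_eqI[of _ _ "{pt}"])
       (use Diag_idn_simps[of C "point_dgm C x :: ('u, 'o, 'a) dgm", unfolded point_dgm_simps] in \<open>auto simp: Cs eta_simps point_dgm_simps\<close>)
  next
    case (10 f g)
    have "is_dmor C (far (eta C) f :: ('u, 'o, 'a) dmor)" "is_dmor C (far (eta C) g :: ('u, 'o, 'a) dmor)"
      "msrc (far (eta C) g :: ('u, 'o, 'a) dmor) = mtgt (far (eta C) f)"
      using 10 by (simp_all add: is_dmor_eta[OF C] eta_simps)
    note I = Diag_cmp_simps[OF this, simplified eta_simps 10 point_dgm_simps]
    show ?case
      by (intro dmor_eqI[of _ _ "{pt}"])
       (use I 10 eta_simps(6)[OF Cs(6)[OF 10]] in
         \<open>auto simp: Cs eta_simps point_dgm_simps comp_functor_id_left[OF is_functor_id] category_one id_functor_simps\<close>)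
  qed (auto simp: C category_Diag Diag_simps eta_simps is_dgm_point is_dmor_eta Cs)
qed

text \<open>Strict naturality of the multiplication on diagrams, by functoriality of
  \<open>F\<close> on the composite that defines the value at an arrow. For \<open>F\<close> the
  colimit functor it says that the two copies of \<open>mult\<close> on one side of the
  associativity law are composable.\<close>

lemma mu_push_star:
  fixes D :: "('u::universe, ('u, 'o, 'a) dgm, ('u, 'o, 'a) dmor) dgm"
    and F :: "('o, 'a, 'p, 'b) ftor"
  assumes F: "is_functor C B F" and D: "is_dgm (Diag C) D"
  shows "mu_dgm B (push_dgm (star C F) D) = push_dgm F (mu_dgm C D)"
proof -
  note C = functor_category(1)[OF F] and B = functor_category(2)[OF F] and Fs = is_functorD[OF F]
  note Ds = is_dgm_DiagD[OF D] and Js = categoryD[OF is_dgmD(2)[OF D]]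
  let ?E = "push_dgm (star C F) D"
  have E: "shape ?E = shape D" "\<And>x. x \<in> obj (shape D) \<Longrightarrow> shape (dob ?E x) = shape (dob D x)"
    "\<And>j. j \<in> arr (shape D) \<Longrightarrow> mfun (dar ?E j) = mfun (dar D j)"
    by (simp_all add: push_dgm_simps star_simps Ds)
  \<comment> \<open>Postcomposition leaves the indexing categories and transition functors alone, so
    the Grothendieck construction is the same category.\<close>
  have sh: "mu_shape ?E = mu_shape D"
    unfolding mu_shape_def E(1) by (rule groth_cong) (simp_all add: E is_dgmD[OF D])
  note simps = push_dgm_simps mu_dgm_simps mu_dgm_simps[where D = ?E, unfolded sh] star_simps Ds Js Fs
  show ?thesis
  proof (rule dgm_eqI)
    show "dfun (mu_dgm B ?E) = dfun (push_dgm F (mu_dgm C D))"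
      using mu_dgm_simps(4,5)[where D = ?E, unfolded sh] push_dgm_simps(4,5)[of F "mu_dgm C D", unfolded mu_dgm_simps]
      by (intro functor_eqI[of _ "obj (mu_shape D)" _ "arr (mu_shape D)"])
        (auto simp: simps functor_DiagD[OF is_dgmD(3)[OF D]] mu_shape_sel elim!: groth_objE groth_arrE)
  qed (simp only: mu_dgm_simps push_dgm_simps sh)
qed

section \<open>Reindexings: the right unitor and the associator\<close>

lemma reindexing_simps:
  "msrc (reindexing C D D' R) = D" "mtgt (reindexing C D D' R) = D'" "mfun (reindexing C D D' R) = R"
  "x \<in> obj (shape D) \<Longrightarrow> mnat (reindexing C D D' R) x = idn C (dob D x)"
  "mnat (reindexing C D D' R) \<in> extensional (obj (shape D))"
  by (simp_all add: reindexing_def)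

lemma is_dmor_reindexing:
  assumes D: "is_dgm C D" and D': "is_dgm C D'" and R: "is_functor (shape D) (shape D') R"
    and ob: "\<And>x. x \<in> obj (shape D) \<Longrightarrow> dob D' (fob R x) = dob D x"
    and ar: "\<And>f. f \<in> arr (shape D) \<Longrightarrow> dar D' (far R f) = dar D f"
  shows "is_dmor C (reindexing C D D' R)"
  by (rule is_dmorI)
    (use D D' R in \<open>simp_all add: reindexing_simps ob ar hom_def categoryD[OF is_dgmD(2)[OF D]]
      categoryD[OF is_dgmD(4)[OF D]] is_functorD[OF is_dgmD(3)[OF D]]\<close>)

text \<open>Every fibre of the pushforward along \<open>eta C\<close> is the point category. The
  value of its multiplication at \<open>garr pt f pt\<close> is an identity composed with
  \<open>dar D f\<close>, so reindexing returns \<open>D\<close> strictly and identity components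
  are natural.\<close>

lemma runit_simps:
  fixes D :: "('u::universe, 'o, 'a) dgm"
  assumes D: "is_dgm C D"
  shows "msrc (runit C D) = D" "mtgt (runit C D) = mu_dgm C (push_dgm (eta C) D)"
    and "x \<in> obj (shape D) \<Longrightarrow> fob (mfun (runit C D)) x = vpair x pt"
    and "x \<in> obj (shape D) \<Longrightarrow> mnat (runit C D) x = idn C (dob D x)"
    and "is_dmor C (runit C D)"
proof -
  define E where "E = push_dgm (eta C :: (_, _, ('u, 'o, 'a) dgm, _) ftor) D"
  note C = is_dgmD(4)[OF D]
  have E: "is_dgm (Diag C) E" unfolding E_def by (rule is_dgm_push[OF is_functor_eta[OF C] D])
  have M: "is_dgm C (mu_dgm C E)" by (rule is_dgm_mu[OF E C])
  note Ds = is_functorD[OF is_dgmD(3)[OF D]] and Js = categoryD[OF is_dgmD(2)[OF D]] and Cs = categoryD[OF C]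
  have Es: "shape E = shape D" "\<And>x. x \<in> obj (shape D) \<Longrightarrow> dob E x = point_dgm C (dob D x)"
    "\<And>j. j \<in> arr (shape D) \<Longrightarrow> dar E j = far (eta C) (dar D j)"
    by (simp_all add: E_def push_dgm_simps eta_simps Ds)
  define R where "R = \<lparr>fob = (\<lambda>X\<in>obj (shape D). vpair X pt), far = (\<lambda>f\<in>arr (shape D). garr pt f pt)\<rparr>"
  have r: "runit C D = reindexing C D (mu_dgm C E) R"
    using D E by (simp add: runit_def Diag_simps R_def E_def star_simps mu_def)
  note simps = mu_shape_sel mu_shape_simps mu_dgm_simps Es Ds Js Cs eta_simps point_dgm_simps id_functor_simps
    comp_functor_simps
  have Rs: "\<And>x. x \<in> obj (shape D) \<Longrightarrow> fob R x = vpair x pt" "\<And>f. f \<in> arr (shape D) \<Longrightarrow> far R f = garr pt f pt"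
    by (simp_all add: R_def)
  have R: "is_functor (shape D) (mu_shape E) R"
  proof (rule is_functorI, goal_cases)
    case 2 show ?case using is_dgmD(2)[OF M] by (simp add: mu_dgm_simps)
  next
    case 3 show ?case by (simp add: R_def)
  next
    case 4 show ?case by (simp add: R_def)
  qed (simp_all add: is_dgmD[OF D] simps Rs)
  show "msrc (runit C D) = D" "mtgt (runit C D) = mu_dgm C (push_dgm (eta C) D)"
    "x \<in> obj (shape D) \<Longrightarrow> fob (mfun (runit C D)) x = vpair x pt"
    "x \<in> obj (shape D) \<Longrightarrow> mnat (runit C D) x = idn C (dob D x)"
    unfolding r reindexing_simps by (simp_all add: E_def Rs reindexing_simps)
  show "is_dmor C (runit C D)"
    unfolding r by (rule is_dmor_reindexing[OF D M]) (simp_all add: R mu_dgm_simps(1) simps Rs)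
qed

text \<open>\<open>P\<close> indexes by \<open>(x, (y, z))\<close> and \<open>M\<close> by
  \<open>((x, y), z)\<close>. Explicit forms for objects and arrows of the first index category
  reduce every obligation on the reindexing functor to the rules for fibres.\<close>

lemma assoc_simps:
  fixes D :: "('u::universe, ('u, ('u, 'o, 'a) dgm, ('u, 'o, 'a) dmor) dgm,
      ('u, ('u, 'o, 'a) dgm, ('u, 'o, 'a) dmor) dmor) dgm"
  assumes D: "is_dgm (Diag (Diag C)) D" and C: "category C"
  shows "msrc (assoc C D) = mu_dgm C (push_dgm (mu C) D)"
    and "mtgt (assoc C D) = mu_dgm C (mu_dgm (Diag C) D)"
    and "\<lbrakk>x \<in> obj (shape D); y \<in> obj (shape (dob D x)); z \<in> obj (shape (dob (dob D x) y))\<rbrakk> \<Longrightarrow>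
      fob (mfun (assoc C D)) (vpair x (vpair y z)) = vpair (vpair x y) z"
    and "\<lbrakk>x \<in> obj (shape D); y \<in> obj (shape (dob D x)); z \<in> obj (shape (dob (dob D x) y))\<rbrakk> \<Longrightarrow>
      mnat (assoc C D) (vpair x (vpair y z)) = idn C (dob (dob (dob D x) y) z)"
    and "is_dmor C (assoc C D)"
proof -
  define P where "P = push_dgm (mu C) D"
  define M where "M = mu_dgm (Diag C) D"
  note DC = category_Diag[OF C]
  have P: "is_dgm (Diag C) P" unfolding P_def by (rule is_dgm_push[OF is_functor_mu[OF C] D])
  have M: "is_dgm (Diag C) M" unfolding M_def by (rule is_dgm_mu[OF D DC])
  have D1: "is_dgm C (mu_dgm C P)" by (rule is_dgm_mu[OF P C])
  have D2: "is_dgm C (mu_dgm C M)" by (rule is_dgm_mu[OF M C])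
  note Ds = is_dgm_DiagD[OF D, unfolded Diag_simps mem_Collect_eq] and Js = categoryD[OF is_dgmD(2)[OF D]]
    and Cs = categoryD[OF C]
  note F = functor_DiagD[OF is_dgmD(3)[OF D]]
  note Es = is_dgm_DiagD[OF Ds(1)]
  note Ks = categoryD[OF Ds(2)] and Ls = categoryD[OF Es(2)]
  have F3: "msrc (dar D j) = dob D x" if "j \<in> arr (shape D)" "src (shape D) j = x" for j x
    using F(3) that by simp
  note m = is_dmor_DiagD[OF Ds(10) F3 F(4)] and mf = is_dmor_Diag_fibre[OF Ds(10) F3 F(4)]
  note F' = functor_DiagD[OF is_dgmD(3)[OF Ds(1)]]
  have Ps: "shape P = shape D" "\<And>x. x \<in> obj (shape D) \<Longrightarrow> dob P x = mu_dgm C (dob D x)"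
    "\<And>j. j \<in> arr (shape D) \<Longrightarrow> dar P j = mu_dmor C (dar D j)"
    by (simp_all add: P_def push_dgm_simps mu_def Diag_simps Ds)
  have Ms: "shape M = mu_shape D" "\<And>x y. vpair x y \<in> obj (mu_shape D) \<Longrightarrow> dob M (vpair x y) = dob (dob D x) y"
    "\<And>X j g. garr X j g \<in> arr (mu_shape D) \<Longrightarrow>
        dar M (garr X j g) = cmp (Diag C) (dar (dob D (tgt (shape D) j)) g) (mnat (dar D j) X)"
    by (simp_all add: M_def mu_dgm_simps)
  note mn = is_dmor_Diag_natural[OF Ds(10) F3 F(4)]
  note comps = mn Diag_cmp_simps Diag_idn_simps[OF Es(1)]
  define R where "R = assoc_ftor (mu_shape P)"
  have a: "assoc C D = reindexing C (mu_dgm C P) (mu_dgm C M) R"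
    using D P M by (simp add: assoc_def Diag_simps R_def P_def M_def star_simps mu_def Let_def mu_dgm_simps)
  note simps = mu_shape_sel mu_shape_simps mu_dgm_simps mu_dmor_simps Ps Ms Ds Js Es Ks Ls Cs m mf F F' comps
    id_functor_simps comp_functor_simps
  have Rs: "vpair x (vpair y z) \<in> obj (mu_shape P) \<Longrightarrow> fob R (vpair x (vpair y z)) = vpair (vpair x y) z"
    "garr (vpair y z) j (garr l g h) \<in> arr (mu_shape P) \<Longrightarrow>
      far R (garr (vpair y z) j (garr l g h)) = garr z (garr y j g) h" for x y z l j g h
    by (simp_all add: R_def assoc_ftor_def)
  have oE: "\<exists>x y z. p = vpair x (vpair y z) \<and> x \<in> obj (shape D) \<and> y \<in> obj (shape (dob D x)) \<and> z \<in> obj (shape (dob (dob D x) y))"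
    if "p \<in> obj (mu_shape P)" for p
    using that by (auto simp: simps elim!: groth_objE)
  \<comment> \<open>The point \<open>l\<close> recorded in the fibre arrow is forced: it is the
    image of \<open>z\<close> under the transition functor lying over \<open>j\<close>. The
    associator can therefore drop it and record \<open>y\<close> and \<open>z\<close>
    instead.\<close>
  have aE: "\<exists>y z j l g h. a = garr (vpair y z) j (garr l g h) \<and> j \<in> arr (shape D) \<and> y \<in> obj (shape (dob D (src (shape D) j))) \<and>
     z \<in> obj (shape (dob (dob D (src (shape D) j)) y)) \<and> g \<in> arr (shape (dob D (tgt (shape D) j))) \<and>
     src (shape (dob D (tgt (shape D) j))) g = fob (mfun (dar D j)) y \<and>
     l = fob (mfun (mnat (dar D j) y)) z \<and> h \<in> arr (shape (dob (dob D (tgt (shape D) j)) (tgt (shape (dob D (tgt (shape D) j))) g))) \<and>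
     src (shape (dob (dob D (tgt (shape D) j)) (tgt (shape (dob D (tgt (shape D) j))) g))) h = fob (mfun (dar (dob D (tgt (shape D) j)) g)) l"
    if "a \<in> arr (mu_shape P)" for a
    using that by (auto simp: simps elim!: groth_objE groth_arrE)
  have R: "is_functor (mu_shape P) (mu_shape M) R"
  proof (rule is_functorI, goal_cases)
    case 1 show ?case using is_dgmD(2)[OF D1] by (simp add: mu_dgm_simps)
  next
    case 2 show ?case using is_dgmD(2)[OF D2] by (simp add: mu_dgm_simps)
  next
    case 3 show ?case by (simp add: R_def assoc_ftor_def)
  next
    case 4 show ?case by (simp add: R_def assoc_ftor_def)
  next
    case (5 x) show ?case using oE[OF 5(1)] by (auto simp: simps Rs)
  next
    case (6 f) show ?case using aE[OF 6(1)] by (auto simp: simps Rs)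
  next
    case (7 f) show ?case using aE[OF 7(1)] by (auto simp: simps Rs)
  next
    case (8 f) show ?case using aE[OF 8(1)] by (auto simp: simps Rs)
  next
    case (9 x) show ?case using oE[OF 9(1)] by (auto simp: simps Rs)
  next
    case (10 f g) show ?case using aE[OF 10(1)] aE[OF 10(2)] 10(3) by (auto simp: simps Rs)
  qed
  show "msrc (assoc C D) = mu_dgm C (push_dgm (mu C) D)"
    "mtgt (assoc C D) = mu_dgm C (mu_dgm (Diag C) D)"
    "\<lbrakk>x \<in> obj (shape D); y \<in> obj (shape (dob D x)); z \<in> obj (shape (dob (dob D x) y))\<rbrakk> \<Longrightarrow>
      fob (mfun (assoc C D)) (vpair x (vpair y z)) = vpair (vpair x y) z"
    "\<lbrakk>x \<in> obj (shape D); y \<in> obj (shape (dob D x)); z \<in> obj (shape (dob (dob D x) y))\<rbrakk> \<Longrightarrow>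
      mnat (assoc C D) (vpair x (vpair y z)) = idn C (dob (dob (dob D x) y) z)"
    unfolding a reindexing_simps by (simp_all add: P_def[symmetric] M_def[symmetric] Rs reindexing_simps simps)
  show "is_dmor C (assoc C D)"
    unfolding a
  proof (rule is_dmor_reindexing[OF D1 D2], unfold mu_dgm_simps(1))
    show "is_functor (mu_shape P) (mu_shape M) R" by fact
    show "dob (mu_dgm C M) (fob R p) = dob (mu_dgm C P) p" if "p \<in> obj (mu_shape P)" for p
      using oE[OF that] by (auto simp: simps Rs)
    \<comment> \<open>The two values are the two bracketings of one composite of three arrows: the
      component over \<open>j\<close>, the component over \<open>g\<close>, and the image of
      \<open>h\<close>.\<close>
    show "dar (mu_dgm C M) (far R a) = dar (mu_dgm C P) a" if "a \<in> arr (mu_shape P)" for a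
      using aE[OF that] by (auto simp: simps Rs category_assoc[OF C])
  qed
qed

section \<open>Colimits\<close>

lemma colimitD:
  assumes c: "is_colimit C D v \<kappa>"
  shows "v \<in> obj C" and "x \<in> obj (shape D) \<Longrightarrow> \<kappa> x \<in> arr C"
    and "x \<in> obj (shape D) \<Longrightarrow> src C (\<kappa> x) = dob D x"
    and "x \<in> obj (shape D) \<Longrightarrow> tgt C (\<kappa> x) = v"
    and "f \<in> arr (shape D) \<Longrightarrow> cmp C (\<kappa> (tgt (shape D) f)) (dar D f) = \<kappa> (src (shape D) f)"
proof -
  have n: "is_nat (shape D) C (dfun D) (const_functor (shape D) C v) \<kappa>" and v: "v \<in> obj C"
    using c by (auto simp: is_colimit_def is_cocone_def)
  note ns = is_natD[OF n] and F = is_nat_functors(1)[OF n]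
  note Js = categoryD[OF functor_category(1)[OF F]] and Cs = categoryD[OF functor_category(2)[OF F]]
  show "v \<in> obj C" by fact
  show "x \<in> obj (shape D) \<Longrightarrow> \<kappa> x \<in> arr C" "x \<in> obj (shape D) \<Longrightarrow> src C (\<kappa> x) = dob D x"
    "x \<in> obj (shape D) \<Longrightarrow> tgt C (\<kappa> x) = v" for x
    by (simp_all add: ns const_functor_simps)
  then show "f \<in> arr (shape D) \<Longrightarrow> cmp C (\<kappa> (tgt (shape D) f)) (dar D f) = \<kappa> (src (shape D) f)"
    using ns(4)[of f] by (simp add: const_functor_simps Js Cs)
qed

lemma colimit_ex1:
  assumes c: "is_colimit C D v \<kappa>" and D: "is_dgm C D" and w: "w \<in> obj C"
    and \<tau>: "\<And>x. x \<in> obj (shape D) \<Longrightarrow> \<tau> x \<in> hom C (dob D x) w"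
    and nat: "\<And>f. f \<in> arr (shape D) \<Longrightarrow> cmp C (\<tau> (tgt (shape D) f)) (dar D f) = \<tau> (src (shape D) f)"
  shows "\<exists>!h. h \<in> hom C v w \<and> (\<forall>x\<in>obj (shape D). cmp C h (\<kappa> x) = \<tau> x)"
proof -
  note Js = categoryD[OF is_dgmD(2)[OF D]] and Cs = categoryD[OF is_dgmD(4)[OF D]]
  \<comment> \<open>\<open>is_cocone\<close> asks for an extensional family, so \<tau> is restricted
    to the objects of the shape; the universal property reads it only there.\<close>
  have "is_cocone C D w (restrict \<tau> (obj (shape D)))"
    unfolding is_cocone_def
    using w \<tau> nat
    by (auto intro!: is_natI simp: is_functor_const is_dgmD[OF D] const_functor_simps Js Cs hom_def)
  then have "\<exists>!h. h \<in> hom C v w \<and> (\<forall>x\<in>obj (shape D). cmp C h (\<kappa> x) = restrict \<tau> (obj (shape D)) x)"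
    using c unfolding is_colimit_def by blast
  then show ?thesis by simp
qed

text \<open>A colimit cocone is jointly epic: following the legs by \<open>h\<close> gives a cocone
  with vertex \<open>tgt C h\<close>, and both \<open>h\<close> and \<open>h'\<close> factor
  it.\<close>

lemma colimit_unique:
  assumes c: "is_colimit C D v \<kappa>" and D: "is_dgm C D"
    and h: "h \<in> arr C" "src C h = v" and h': "h' \<in> arr C" "src C h' = v" "tgt C h' = tgt C h"
    and eq: "\<And>x. x \<in> obj (shape D) \<Longrightarrow> cmp C h (\<kappa> x) = cmp C h' (\<kappa> x)"
  shows "h = h'"
proof -
  note Js = categoryD[OF is_dgmD(2)[OF D]] and Cs = categoryD[OF is_dgmD(4)[OF D]]
  note k = colimitD[OF c]
  have "\<exists>!g. g \<in> hom C v (tgt C h) \<and> (\<forall>x\<in>obj (shape D). cmp C g (\<kappa> x) = cmp C h (\<kappa> x))"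
    by (rule colimit_ex1[OF c D])
      (use h in \<open>simp_all add: Cs Js k hom_def category_assoc[OF is_dgmD(4)[OF D]] is_functorD[OF is_dgmD(3)[OF D]]\<close>)
  moreover have "h \<in> hom C v (tgt C h)" "h' \<in> hom C v (tgt C h)" using h h' by (simp_all add: hom_def)
  ultimately show ?thesis using eq by metis
qed

section \<open>Chosen colimit cocones and their cancellation laws\<close>

locale chosen_colimits =
  fixes C :: "('o, 'a) cat"
    and v :: "('u::universe, 'o, 'a) dgm \<Rightarrow> 'o"
    and \<kappa> :: "('u, 'o, 'a) dgm \<Rightarrow> 'u \<Rightarrow> 'a"
  assumes C: "category C" and choice: "colimit_choice C v \<kappa>"
begin

abbreviation comp_arr (infixr "\<cdot>" 70)
  where "g \<cdot> f \<equiv> cmp C g f"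

lemmas Cs = categoryD[OF C]

lemma colimit: "is_dgm C D \<Longrightarrow> is_colimit C D (v D) (\<kappa> D)"
  using choice by (simp add: colimit_choice_def)

lemmas k = colimitD[OF colimit]

text \<open>The cocone law with a trailing factor, for use inside composites nested to the right;
  \<open>y\<close> is a variable so that the object labelling the leg need not be displayed as a
  target.\<close>

lemma k_natural:
  assumes "is_dgm C D" "f \<in> arr (shape D)" "tgt (shape D) f = y" "g \<in> arr C" "tgt C g = dob D (src (shape D) f)"
  shows "\<kappa> D y \<cdot> (dar D f \<cdot> g) = \<kappa> D (src (shape D) f) \<cdot> g"
  using assms(1,2,4,5) k(5)[OF assms(1,2)] unfolding assms(3)[symmetric]
  by (simp add: category_assoc[OF C, symmetric] k is_functorD[OF is_dgmD(3)] categoryD[OF is_dgmD(2)] del: k(5))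

lemma colim_eqI:
  assumes "is_dgm C D" "h \<in> arr C" "src C h = v D" "h' \<in> arr C" "src C h' = v D" "tgt C h' = tgt C h"
    and "\<And>x. x \<in> obj (shape D) \<Longrightarrow> h \<cdot> \<kappa> D x = h' \<cdot> \<kappa> D x"
  shows "h = h'"
  using colimit_unique[OF colimit[OF assms(1)]] assms by blast

lemma colim_ex1:
  assumes "is_dgm C D" "w \<in> obj C"
    and "\<And>x. x \<in> obj (shape D) \<Longrightarrow> \<tau> x \<in> hom C (dob D x) w"
    and "\<And>f. f \<in> arr (shape D) \<Longrightarrow> \<tau> (tgt (shape D) f) \<cdot> dar D f = \<tau> (src (shape D) f)"
  shows "\<exists>!h. h \<in> hom C (v D) w \<and> (\<forall>x\<in>obj (shape D). h \<cdot> \<kappa> D x = \<tau> x)"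
  using assms by (intro colimit_ex1[OF colimit])

section \<open>The colimit functor\<close>

definition colim :: "(('u, 'o, 'a) dgm, ('u, 'o, 'a) dmor, 'o, 'a) ftor"
  where "colim = \<lparr>fob = (\<lambda>D\<in>obj (Diag C). v D),
    far = (\<lambda>m\<in>arr (Diag C). THE h. h \<in> hom C (v (msrc m)) (v (mtgt m)) \<and>
      (\<forall>x\<in>obj (shape (msrc m)). h \<cdot> \<kappa> (msrc m) x = \<kappa> (mtgt m) (fob (mfun m) x) \<cdot> mnat m x))\<rparr>"

lemma fob_colim: "is_dgm C D \<Longrightarrow> fob colim D = v D"
  by (simp add: colim_def Diag_simps)

text \<open>The last two conclusions say how a comparison arrow passes a leg. They mention
  \<open>D\<close> with the premise \<open>msrc m = D\<close>, since the leg in a goal usually names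
  the source diagram in another form.\<close>

lemma far_colim:
  assumes m: "is_dmor C m"
  shows "far colim m \<in> arr C" "src C (far colim m) = v (msrc m)" "tgt C (far colim m) = v (mtgt m)"
    and "\<lbrakk>msrc m = D; x \<in> obj (shape D)\<rbrakk> \<Longrightarrow>
      far colim m \<cdot> \<kappa> D x = \<kappa> (mtgt m) (fob (mfun m) x) \<cdot> mnat m x"
    and "\<lbrakk>msrc m = D; x \<in> obj (shape D); g \<in> arr C; tgt C g = dob D x\<rbrakk> \<Longrightarrow>
      far colim m \<cdot> (\<kappa> D x \<cdot> g) = \<kappa> (mtgt m) (fob (mfun m) x) \<cdot> (mnat m x \<cdot> g)"
proof -
  note ms = is_dmorD[OF m]
  note Js = categoryD[OF is_dgmD(2)[OF ms(1)]] and R = is_functorD[OF ms(3)]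
  note S = is_functorD[OF is_dgmD(3)[OF ms(1)]] and T = is_functorD[OF is_dgmD(3)[OF ms(2)]]
  let ?P = "\<lambda>h. h \<in> hom C (v (msrc m)) (v (mtgt m)) \<and>
      (\<forall>x\<in>obj (shape (msrc m)). h \<cdot> \<kappa> (msrc m) x = \<kappa> (mtgt m) (fob (mfun m) x) \<cdot> mnat m x)"
  have "\<exists>!h. ?P h"
  proof (rule colim_ex1)
    \<comment> \<open>The legs of the target, reindexed along \<open>mfun m\<close> and preceded by
      \<open>mnat m\<close>, form a cocone: naturality of \<open>mnat m\<close> moves the image of
      \<open>f\<close> to the target diagram, where the cocone law at \<open>far (mfun m) f\<close>
      absorbs it.\<close>
    fix f assume f: "f \<in> arr (shape (msrc m))"
    show "(\<kappa> (mtgt m) (fob (mfun m) (tgt (shape (msrc m)) f)) \<cdot> mnat m (tgt (shape (msrc m)) f)) \<cdot> dar (msrc m) f =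
      \<kappa> (mtgt m) (fob (mfun m) (src (shape (msrc m)) f)) \<cdot> mnat m (src (shape (msrc m)) f)"
      using f k_natural[of "mtgt m" "far (mfun m) f" _ "mnat m (src (shape (msrc m)) f)"]
      by (simp add: category_assoc[OF C] ms Js R k Cs S)
  qed (simp_all add: ms k hom_def Cs R)
  then have "?P (THE h. ?P h)" by (rule theI')
  then have P: "?P (far colim m)" using m by (simp add: colim_def Diag_simps)
  then show 1: "far colim m \<in> arr C" "src C (far colim m) = v (msrc m)" "tgt C (far colim m) = v (mtgt m)"
    by (simp_all add: hom_def)
  show 2: "\<lbrakk>msrc m = D; x \<in> obj (shape D)\<rbrakk> \<Longrightarrow>
      far colim m \<cdot> \<kappa> D x = \<kappa> (mtgt m) (fob (mfun m) x) \<cdot> mnat m x" for D x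
    using P by auto
  show "\<lbrakk>msrc m = D; x \<in> obj (shape D); g \<in> arr C; tgt C g = dob D x\<rbrakk> \<Longrightarrow>
      far colim m \<cdot> (\<kappa> D x \<cdot> g) = \<kappa> (mtgt m) (fob (mfun m) x) \<cdot> (mnat m x \<cdot> g)"
    using 2[of D x] ms 1 by (auto simp: category_assoc[OF C, symmetric] k R)
qed

lemma is_functor_colim: "is_functor (Diag C) C colim"
proof (rule is_functorI, goal_cases)
  case (9 D)
  then have D: "is_dgm C D" by (simp add: Diag_simps)
  note i = is_dmor_idn[OF D] and I = Diag_idn_simps[OF D] and Ds = is_functorD[OF is_dgmD(3)[OF D]]
  show ?case
    by (rule colim_eqI[OF D])
      (simp_all add: far_colim[OF i] far_colim(4)[OF i, of D] I id_functor_simps Cs k D fob_colim Ds)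
next
  case (10 m n)
  then have m: "is_dmor C m" and n: "is_dmor C n" and mn: "msrc n = mtgt m" by (auto simp: Diag_simps)
  note nm = is_dmor_cmp[OF m n mn] and I = Diag_cmp_simps[OF m n mn]
  note ms = is_dmorD[OF m] and ns = is_dmorD[OF n, unfolded mn] and R = is_functorD[OF is_dmorD(3)[OF m]]
    and R' = is_functorD[OF is_dmorD(3)[OF n, unfolded mn]]
  show ?case
    by (rule colim_eqI[OF ms(1)])
      (simp_all add: far_colim nm m n mn I comp_functor_simps Cs k ms ns R R' category_assoc[OF C])
qed (auto simp: C category_Diag Diag_simps fob_colim far_colim k is_dmorD, auto simp: colim_def Diag_simps)

lemma is_colimit_functor_colim: "is_colimit_functor C v \<kappa> colim"
  by (simp add: is_colimit_functor_def is_functor_colim fob_colim far_colim)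

section \<open>Colimits of one-point diagrams\<close>

definition counit :: "'o \<Rightarrow> 'a"
  where "counit = (\<lambda>x\<in>obj C. THE h. h \<in> hom C (v (point_dgm C x)) x \<and> h \<cdot> \<kappa> (point_dgm C x) pt = idn C x)"

lemma counit:
  assumes x: "x \<in> obj C"
  shows "counit x \<in> arr C" "src C (counit x) = v (point_dgm C x)" "tgt C (counit x) = x"
    and "counit x \<cdot> \<kappa> (point_dgm C x) pt = idn C x"
    and "g \<in> arr C \<Longrightarrow> tgt C g = x \<Longrightarrow> counit x \<cdot> (\<kappa> (point_dgm C x) pt \<cdot> g) = g"
proof -
  have p: "is_dgm C (point_dgm C x :: ('u, 'o, 'a) dgm)" by (rule is_dgm_point[OF C x])
  let ?P = "\<lambda>h. h \<in> hom C (v (point_dgm C x)) x \<and> h \<cdot> \<kappa> (point_dgm C x) pt = idn C x"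
  \<comment> \<open>The only arrow of the point category goes to an identity, so
    \<open>idn C x\<close> alone is a cocone with vertex \<open>x\<close>.\<close>
  have "\<exists>!h. ?P h"
    using colim_ex1[OF p, of x "\<lambda>_. idn C x"] x by (simp add: point_dgm_simps hom_def Cs)
  then have "?P (THE h. ?P h)" by (rule theI')
  then have P: "?P (counit x)" using x by (simp add: counit_def)
  then show 1: "counit x \<in> arr C" "src C (counit x) = v (point_dgm C x)" "tgt C (counit x) = x"
    "counit x \<cdot> \<kappa> (point_dgm C x) pt = idn C x"
    by (simp_all add: hom_def)
  show "g \<in> arr C \<Longrightarrow> tgt C g = x \<Longrightarrow> counit x \<cdot> (\<kappa> (point_dgm C x) pt \<cdot> g) = g"
    using 1 p by (simp add: category_assoc[OF C, symmetric] k point_dgm_simps Cs)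
qed

lemma is_nat_iso_counit: "is_nat_iso C C (comp_functor C colim (eta C)) (id_functor C) counit"
proof -
  have p: "x \<in> obj C \<Longrightarrow> is_dgm C (point_dgm C x :: ('u, 'o, 'a) dgm)" for x by (rule is_dgm_point[OF C])
  have e: "f \<in> arr C \<Longrightarrow> is_dmor C (far (eta C) f :: ('u, 'o, 'a) dmor)" for f by (rule is_dmor_eta[OF C])
  note simps = comp_functor_simps id_functor_simps eta_simps fob_colim p e counit hom_def Cs far_colim
    point_dgm_simps k category_assoc[OF C]
  have "counit (tgt C f) \<cdot> far colim (far (eta C) f) = f \<cdot> counit (src C f)" if "f \<in> arr C" for f
    by (rule colim_eqI[OF p[of "src C f"]]) (use that in \<open>simp_all add: simps\<close>)
  then have "is_nat C C (comp_functor C colim (eta C)) (id_functor C) counit"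
    by (intro is_natI is_functor_comp[OF is_functor_eta[OF C] is_functor_colim] is_functor_id C)
      (simp_all add: simps, simp add: counit_def)
  moreover have "is_iso C (counit x)" if x: "x \<in> obj C" for x
    unfolding is_iso_def
  proof (intro conjI bexI)
    \<comment> \<open>The inverse is the single leg of the cocone. Being a whole colimit cocone,
      this leg is epic, and precomposing with it settles this composite.\<close>
    show "\<kappa> (point_dgm C x) pt \<cdot> counit x = idn C (src C (counit x))"
      by (rule colim_eqI[OF p[OF x]]) (use x in \<open>simp_all add: simps\<close>)
  qed (use x in \<open>simp_all add: simps\<close>)
  ultimately show ?thesis by (simp add: is_nat_iso_def)
qed

section \<open>Iterated colimits and colimits over the Grothendieck construction\<close>

lemma colim_star_dgm: "is_dgm (Diag C) D \<Longrightarrow> is_dgm C (push_dgm colim D)"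
  by (rule is_dgm_push[OF is_functor_colim])

lemma colim_star_simps:
  assumes D: "is_dgm (Diag C) D"
  shows "shape (push_dgm colim D) = shape D"
    and "x \<in> obj (shape D) \<Longrightarrow> dob (push_dgm colim D) x = v (dob D x)"
    and "j \<in> arr (shape D) \<Longrightarrow> dar (push_dgm colim D) j = far colim (dar D j)"
  by (simp_all add: push_dgm_simps fob_colim is_dgm_DiagD[OF D])

text \<open>Cancellation is applied twice: to the cocone of the outer diagram of colimits, and then,
  for each \<open>x\<close>, to the cocone of \<open>dob D x\<close>.\<close>

lemma colim_eqI2:
  assumes D: "is_dgm (Diag C) D"
    and h: "h \<in> arr C" "src C h = v (push_dgm colim D)"
    and h': "h' \<in> arr C" "src C h' = v (push_dgm colim D)" "tgt C h' = tgt C h"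
    and eq: "\<And>x y. x \<in> obj (shape D) \<Longrightarrow> y \<in> obj (shape (dob D x)) \<Longrightarrow>
      h \<cdot> \<kappa> (push_dgm colim D) x \<cdot> \<kappa> (dob D x) y = h' \<cdot> \<kappa> (push_dgm colim D) x \<cdot> \<kappa> (dob D x) y"
  shows "h = h'"
proof (rule colim_eqI[OF colim_star_dgm[OF D] h h'])
  fix x assume "x \<in> obj (shape (push_dgm colim D))"
  then have x: "x \<in> obj (shape D)" by (simp add: colim_star_simps[OF D])
  show "h \<cdot> \<kappa> (push_dgm colim D) x = h' \<cdot> \<kappa> (push_dgm colim D) x"
    by (rule colim_eqI[OF is_dgm_DiagD(1)[OF D x]])
      (use x h h' eq in \<open>simp_all add: k Cs colim_star_dgm D colim_star_simps category_assoc[OF C] is_dgm_DiagD[OF D]\<close>)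
qed

text \<open>The last two conclusions are the cocone law over the Grothendieck construction for its
  two generating kinds of arrow: inside a fibre, and opcartesian over the base.\<close>

lemma mu_k:
  assumes D: "is_dgm (Diag C) D"
  shows "\<lbrakk>x \<in> obj (shape D); y \<in> obj (shape (dob D x))\<rbrakk> \<Longrightarrow> \<kappa> (mu_dgm C D) (vpair x y) \<in> arr C"
    and "\<lbrakk>x \<in> obj (shape D); y \<in> obj (shape (dob D x))\<rbrakk> \<Longrightarrow>
      src C (\<kappa> (mu_dgm C D) (vpair x y)) = dob (dob D x) y"
    and "\<lbrakk>x \<in> obj (shape D); y \<in> obj (shape (dob D x))\<rbrakk> \<Longrightarrow>
      tgt C (\<kappa> (mu_dgm C D) (vpair x y)) = v (mu_dgm C D)"
    and "\<lbrakk>x \<in> obj (shape D); f \<in> arr (shape (dob D x))\<rbrakk> \<Longrightarrow>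
      \<kappa> (mu_dgm C D) (vpair x (tgt (shape (dob D x)) f)) \<cdot> dar (dob D x) f =
      \<kappa> (mu_dgm C D) (vpair x (src (shape (dob D x)) f))"
    and "\<lbrakk>j \<in> arr (shape D); y \<in> obj (shape (dob D (src (shape D) j)))\<rbrakk> \<Longrightarrow>
      \<kappa> (mu_dgm C D) (vpair (tgt (shape D) j) (fob (mfun (dar D j)) y)) \<cdot> mnat (dar D j) y =
      \<kappa> (mu_dgm C D) (vpair (src (shape D) j) y)"
proof -
  note M = is_dgm_mu[OF D C] and Ds = is_dgm_DiagD[OF D] and Js = categoryD[OF is_dgmD(2)[OF D]]
  note Ks = categoryD[OF Ds(2)]
  note simps = mu_dgm_simps mu_shape_sel mu_shape_simps Ds Js Ks Cs id_functor_simps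
  show "\<lbrakk>x \<in> obj (shape D); y \<in> obj (shape (dob D x))\<rbrakk> \<Longrightarrow> \<kappa> (mu_dgm C D) (vpair x y) \<in> arr C"
    "\<lbrakk>x \<in> obj (shape D); y \<in> obj (shape (dob D x))\<rbrakk> \<Longrightarrow>
      src C (\<kappa> (mu_dgm C D) (vpair x y)) = dob (dob D x) y"
    "\<lbrakk>x \<in> obj (shape D); y \<in> obj (shape (dob D x))\<rbrakk> \<Longrightarrow>
      tgt C (\<kappa> (mu_dgm C D) (vpair x y)) = v (mu_dgm C D)" for x y
    by (simp_all add: k M simps)
  show "\<lbrakk>x \<in> obj (shape D); f \<in> arr (shape (dob D x))\<rbrakk> \<Longrightarrow>
      \<kappa> (mu_dgm C D) (vpair x (tgt (shape (dob D x)) f)) \<cdot> dar (dob D x) f =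
      \<kappa> (mu_dgm C D) (vpair x (src (shape (dob D x)) f))"
    \<comment> \<open>The vertical arrow given by \<open>f\<close>, lying over the identity of
      \<open>x\<close>.\<close>
    using k(5)[OF M, of "garr (src (shape (dob D x)) f) (idn (shape D) x) f"] by (simp add: simps)
  show "\<lbrakk>j \<in> arr (shape D); y \<in> obj (shape (dob D (src (shape D) j)))\<rbrakk> \<Longrightarrow>
      \<kappa> (mu_dgm C D) (vpair (tgt (shape D) j) (fob (mfun (dar D j)) y)) \<cdot> mnat (dar D j) y =
      \<kappa> (mu_dgm C D) (vpair (src (shape D) j) y)"
    \<comment> \<open>The opcartesian arrow over \<open>j\<close> at \<open>y\<close>, whose fibre
      part is an identity.\<close>
    using k(5)[OF M, of "garr y j (idn (shape (dob D (tgt (shape D) j))) (fob (mfun (dar D j)) y))"]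
    by (simp add: simps)
qed

definition mult :: "('u, ('u, 'o, 'a) dgm, ('u, 'o, 'a) dmor) dgm \<Rightarrow> 'a"
  where "mult = (\<lambda>D\<in>obj (Diag (Diag C)). THE h. h \<in> hom C (v (push_dgm colim D)) (v (mu_dgm C D)) \<and>
    (\<forall>x\<in>obj (shape D). \<forall>y\<in>obj (shape (dob D x)).
      h \<cdot> \<kappa> (push_dgm colim D) x \<cdot> \<kappa> (dob D x) y = \<kappa> (mu_dgm C D) (vpair x y)))"

lemma mult:
  assumes D: "is_dgm (Diag C) D"
  shows "mult D \<in> arr C" "src C (mult D) = v (push_dgm colim D)" "tgt C (mult D) = v (mu_dgm C D)"
    and "\<lbrakk>x \<in> obj (shape D); dob D x = E; y \<in> obj (shape E)\<rbrakk> \<Longrightarrow>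
      mult D \<cdot> \<kappa> (push_dgm colim D) x \<cdot> \<kappa> E y = \<kappa> (mu_dgm C D) (vpair x y)"
    and "\<lbrakk>x \<in> obj (shape D); dob D x = E; y \<in> obj (shape E); g \<in> arr C; tgt C g = dob E y\<rbrakk> \<Longrightarrow>
      mult D \<cdot> \<kappa> (push_dgm colim D) x \<cdot> \<kappa> E y \<cdot> g = \<kappa> (mu_dgm C D) (vpair x y) \<cdot> g"
proof -
  note M = is_dgm_mu[OF D C] and P = colim_star_dgm[OF D] and Ds = is_dgm_DiagD[OF D]
  note Js = categoryD[OF is_dgmD(2)[OF D]] and Ks = categoryD[OF Ds(2)] and F = functor_DiagD[OF is_dgmD(3)[OF D]]
  note simps = colim_star_simps[OF D] M P Ds Js Ks F Cs hom_def far_colim k mu_k D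
  let ?P = "\<lambda>h. h \<in> hom C (v (push_dgm colim D)) (v (mu_dgm C D)) \<and>
    (\<forall>x\<in>obj (shape D). \<forall>y\<in>obj (shape (dob D x)).
      h \<cdot> \<kappa> (push_dgm colim D) x \<cdot> \<kappa> (dob D x) y = \<kappa> (mu_dgm C D) (vpair x y))"
  \<comment> \<open>For fixed \<open>x\<close>, the legs at the pairs \<open>(x, y)\<close> form a
    cocone on \<open>dob D x\<close> by the law for vertical arrows.\<close>
  have "\<exists>h. h \<in> hom C (v (dob D x)) (v (mu_dgm C D)) \<and>
      (\<forall>y\<in>obj (shape (dob D x)). h \<cdot> \<kappa> (dob D x) y = \<kappa> (mu_dgm C D) (vpair x y))"
    if "x \<in> obj (shape D)" for x
    by (rule ex1_implies_ex, rule colim_ex1) (use that in \<open>simp_all add: simps\<close>)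
  then obtain h where "\<forall>x\<in>obj (shape D). h x \<in> hom C (v (dob D x)) (v (mu_dgm C D)) \<and>
      (\<forall>y\<in>obj (shape (dob D x)). h x \<cdot> \<kappa> (dob D x) y = \<kappa> (mu_dgm C D) (vpair x y))"
    by metis
  then have h: "h x \<in> arr C" "src C (h x) = v (dob D x)" "tgt C (h x) = v (mu_dgm C D)"
    "\<And>y. y \<in> obj (shape (dob D x)) \<Longrightarrow> h x \<cdot> \<kappa> (dob D x) y = \<kappa> (mu_dgm C D) (vpair x y)"
    if "x \<in> obj (shape D)" for x
    using that by (auto simp: hom_def)
  have h': "h x \<cdot> \<kappa> (dob D x) y \<cdot> g = \<kappa> (mu_dgm C D) (vpair x y) \<cdot> g"
    if "x \<in> obj (shape D)" "y \<in> obj (shape (dob D x))" "g \<in> arr C" "tgt C g = dob (dob D x) y" for x y g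
    using h[OF that(1)] that by (simp add: category_assoc[OF C, symmetric] simps)
  \<comment> \<open>Compatibility of the family \<open>h\<close> with the outer diagram: after
    precomposition with a leg of the inner colimit it is the law for opcartesian arrows.\<close>
  have hj: "h (tgt (shape D) j) \<cdot> dar (push_dgm colim D) j = h (src (shape D) j)" if j: "j \<in> arr (shape D)" for j
    by (rule colim_eqI[OF Ds(1)[of "src (shape D) j"]])
      (use j in \<open>simp_all add: simps h h' category_assoc[OF C]\<close>)
  have "\<exists>!h0. h0 \<in> hom C (v (push_dgm colim D)) (v (mu_dgm C D)) \<and>
      (\<forall>x\<in>obj (shape (push_dgm colim D)). h0 \<cdot> \<kappa> (push_dgm colim D) x = h x)"
  proof (rule colim_ex1[OF P])
    show "v (mu_dgm C D) \<in> obj C" by (rule k(1)[OF M])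
  qed (unfold colim_star_simps(1)[OF D], use hj h in \<open>simp_all add: colim_star_simps(2)[OF D] hom_def\<close>)
  then obtain h0 where h0: "h0 \<in> arr C" "src C h0 = v (push_dgm colim D)" "tgt C h0 = v (mu_dgm C D)"
    "\<And>x. x \<in> obj (shape D) \<Longrightarrow> h0 \<cdot> \<kappa> (push_dgm colim D) x = h x"
    unfolding colim_star_simps(1)[OF D] hom_def by blast
  have "?P h0"
    using h0 h by (simp add: simps category_assoc[OF C, symmetric])
  \<comment> \<open>The definite description also needs uniqueness, which is cancellation of
    composites of an outer and an inner leg.\<close>
  moreover have "h = h'" if "?P h" "?P h'" for h h'
    by (rule colim_eqI2[OF D]) (use that in \<open>auto simp: hom_def\<close>)
  ultimately have "?P (THE h. ?P h)" by (intro theI[of ?P]) auto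
  then have P': "?P (mult D)" using D by (simp add: mult_def Diag_simps)
  then show 1: "mult D \<in> arr C" "src C (mult D) = v (push_dgm colim D)" "tgt C (mult D) = v (mu_dgm C D)"
    by (simp_all add: hom_def)
  show 2: "\<lbrakk>x \<in> obj (shape D); dob D x = E; y \<in> obj (shape E)\<rbrakk> \<Longrightarrow>
      mult D \<cdot> \<kappa> (push_dgm colim D) x \<cdot> \<kappa> E y = \<kappa> (mu_dgm C D) (vpair x y)" for x y E
    using P' by auto
  show "\<lbrakk>x \<in> obj (shape D); dob D x = E; y \<in> obj (shape E); g \<in> arr C; tgt C g = dob E y\<rbrakk> \<Longrightarrow>
      mult D \<cdot> \<kappa> (push_dgm colim D) x \<cdot> \<kappa> E y \<cdot> g = \<kappa> (mu_dgm C D) (vpair x y) \<cdot> g"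
    using arg_cong[OF 2[of x E y], of "\<lambda>h. h \<cdot> g"] 1 by (auto simp: category_assoc[OF C] simps)
qed

text \<open>Composites of an outer with an inner leg form a cocone on \<open>mu_dgm C D\<close>. The
  arrow this induces is inverse to \<open>mult D\<close>, as both composites fix the respective
  jointly epic families.\<close>

lemma is_iso_mult:
  assumes D: "is_dgm (Diag C) D"
  shows "is_iso C (mult D)"
proof -
  note M = is_dgm_mu[OF D C] and P = colim_star_dgm[OF D] and Ds = is_dgm_DiagD[OF D]
  note Js = categoryD[OF is_dgmD(2)[OF D]] and Ks = categoryD[OF Ds(2)] and F = functor_DiagD[OF is_dgmD(3)[OF D]]
  note simps = colim_star_simps[OF D] M P Ds Js Ks F Cs hom_def far_colim k mu_k D mult[OF D]
  have "\<exists>h. h \<in> hom C (v (mu_dgm C D)) (v (push_dgm colim D)) \<and>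
    (\<forall>p\<in>obj (shape (mu_dgm C D)). h \<cdot> \<kappa> (mu_dgm C D) p =
      \<kappa> (push_dgm colim D) (vfst p) \<cdot> \<kappa> (dob D (vfst p)) (vsnd p))"
  proof (rule ex1_implies_ex, rule colim_ex1[OF M], unfold mu_dgm_simps(1))
    fix a assume "a \<in> arr (mu_shape D)"
    then obtain X j f where a: "a = garr X j f" "j \<in> arr (shape D)" "X \<in> obj (shape (dob D (src (shape D) j)))"
      "f \<in> arr (shape (dob D (tgt (shape D) j)))"
      "src (shape (dob D (tgt (shape D) j))) f = fob (mfun (dar D j)) X"
      by (auto simp: mu_shape_sel elim!: groth_arrE)
    let ?E = "dob D (tgt (shape D) j)"
    \<comment> \<open>The inner cocone absorbs the fibre arrow \<open>f\<close>; what remains is the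
      defining equation of the comparison arrow \<open>far colim (dar D j)\<close>, read from right
      to left.\<close>
    have "\<kappa> (push_dgm colim D) (tgt (shape D) j) \<cdot> \<kappa> ?E (tgt (shape ?E) f) \<cdot> dar ?E f \<cdot> mnat (dar D j) X =
      \<kappa> (push_dgm colim D) (tgt (shape D) j) \<cdot> far colim (dar D j) \<cdot> \<kappa> (dob D (src (shape D) j)) X"
      using a by (simp add: simps k_natural)
    also have "\<dots> = \<kappa> (push_dgm colim D) (src (shape D) j) \<cdot> \<kappa> (dob D (src (shape D) j)) X"
      \<comment> \<open>The comparison arrow is the value of the outer diagram at \<open>j\<close>,
        so the outer cocone absorbs it. Rule \<open>far_colim(4)\<close> is withheld because it
        would unfold this arrow before the cocone law applies.\<close>
      using a k_natural[OF P, of j _ "\<kappa> (dob D (src (shape D) j)) X"] by (simp add: simps del: far_colim(4))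
    finally show "(\<kappa> (push_dgm colim D) (vfst (tgt (mu_shape D) a)) \<cdot>
        \<kappa> (dob D (vfst (tgt (mu_shape D) a))) (vsnd (tgt (mu_shape D) a))) \<cdot> dar (mu_dgm C D) a =
      \<kappa> (push_dgm colim D) (vfst (src (mu_shape D) a)) \<cdot> \<kappa> (dob D (vfst (src (mu_shape D) a))) (vsnd (src (mu_shape D) a))"
      using a by (simp add: simps mu_dgm_simps mu_shape_sel mu_shape_simps category_assoc[OF C])
  qed (auto simp: simps mu_dgm_simps mu_shape_sel elim!: groth_objE)
  then obtain h where h: "h \<in> arr C" "src C h = v (mu_dgm C D)" "tgt C h = v (push_dgm colim D)"
    "\<And>x y. x \<in> obj (shape D) \<Longrightarrow> y \<in> obj (shape (dob D x)) \<Longrightarrow>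
      h \<cdot> \<kappa> (mu_dgm C D) (vpair x y) = \<kappa> (push_dgm colim D) x \<cdot> \<kappa> (dob D x) y"
    by (auto simp: hom_def mu_dgm_simps mu_shape_sel)
  have "h \<cdot> mult D = idn C (v (push_dgm colim D))"
    by (rule colim_eqI2[OF D]) (simp_all add: simps h category_assoc[OF C])
  moreover have "mult D \<cdot> h = idn C (v (mu_dgm C D))"
    by (rule colim_eqI[OF M])
      (auto simp: simps h category_assoc[OF C] mu_dgm_simps mu_shape_sel elim!: groth_objE)
  ultimately show ?thesis
    unfolding is_iso_def using h by (auto simp: simps)
qed

lemma mult_natural:
  assumes m: "is_dmor (Diag C) m"
  shows "mult (mtgt m) \<cdot> far colim (far (star (Diag C) colim) m) = far colim (mu_dmor C m) \<cdot> mult (msrc m)"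
proof -
  note ms = is_dmorD[OF m] and mm = is_dmor_DiagD[OF m refl refl] and mf = is_dmor_Diag_fibre[OF m refl refl]
  note R = is_functorD[OF ms(3)] and sm = is_dmor_star[OF is_functor_colim m]
  note simps = colim_star_simps is_dgm_mu C colim_star_dgm is_dgm_DiagD ms(1,2) R mm mf mult mu_k k Cs far_colim
    is_dmor_mu m mu_dmor_simps mu_dgm_simps mu_shape_sel sm star_simps
  \<comment> \<open>On the legs at \<open>x\<close> and \<open>y\<close> both sides become the leg
    of \<open>mu_dgm C (mtgt m)\<close> at the image of \<open>(x, y)\<close>, preceded by
    \<open>mnat (mnat m x) y\<close>.\<close>
  show ?thesis
    by (rule colim_eqI2[OF ms(1)]) (simp_all add: simps category_assoc[OF C])
qed

lemma is_nat_iso_mult: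
  "is_nat_iso (Diag (Diag C)) C (comp_functor (Diag (Diag C)) colim (star (Diag C) colim))
     (comp_functor (Diag (Diag C)) colim (mu C)) mult"
proof -
  have 1: "is_functor (Diag (Diag C)) C (comp_functor (Diag (Diag C)) colim (star (Diag C) colim))"
    by (rule is_functor_comp[OF is_functor_star[OF is_functor_colim] is_functor_colim])
  have 2: "is_functor (Diag (Diag C)) C (comp_functor (Diag (Diag C)) colim (mu C))"
    by (rule is_functor_comp[OF is_functor_mu[OF C] is_functor_colim])
  have "is_nat (Diag (Diag C)) C (comp_functor (Diag (Diag C)) colim (star (Diag C) colim))
     (comp_functor (Diag (Diag C)) colim (mu C)) mult"
    by (rule is_natI[OF 1 2])
      (auto simp: comp_functor_simps Diag_simps star_simps fob_colim colim_star_dgm is_dgm_mu C hom_def mult mu_def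
        mult_natural, auto simp: mult_def Diag_simps)
  then show ?thesis by (simp add: is_nat_iso_def is_iso_mult Diag_simps)
qed

section \<open>The unit and associativity laws\<close>

lemma mult_unit:
  assumes D: "is_dgm C D"
  shows "mult (push_dgm (eta C) D) =
    far colim (runit C D) \<cdot> far colim (nat_star C (comp_functor C colim (eta C)) (id_functor C) counit D)"
proof -
  let ?E = "push_dgm (eta C :: (_, _, ('u, 'o, 'a) dgm, _) ftor) D"
  have E: "is_dgm (Diag C) ?E" by (rule is_dgm_push[OF is_functor_eta[OF C] D])
  have n: "is_nat C C (comp_functor C colim (eta C)) (id_functor C) counit"
    using is_nat_iso_counit by (simp add: is_nat_iso_def)
  note Ds = is_functorD[OF is_dgmD(3)[OF D]]
  note simps = nat_star_simps is_dmor_nat_star[OF n] D push_dgm_id push_dgm_comp runit_simps far_colim k Cs Ds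
    mult E is_dgm_mu[OF E C] push_dgm_simps eta_simps point_dgm_simps colim_star_dgm counit
    is_dgm_point[OF C] id_functor_simps comp_functor_simps mu_k fob_colim category_assoc[OF C]
  \<comment> \<open>On the leg at \<open>x\<close> followed by the leg of the point diagram, both
    sides become the leg at \<open>vpair x pt\<close>: on the right \<open>counit\<close> cancels
    the inner leg, and the unitor reindexes \<open>x\<close>.\<close>
  show ?thesis
    by (rule colim_eqI2[OF E]) (simp_all add: simps)
qed

lemma mult_assoc:
  assumes D: "is_dgm (Diag (Diag C)) D"
  shows "far colim (assoc C D) \<cdot> mult (push_dgm (mu C) D) \<cdot>
      far colim (nat_star (Diag (Diag C)) (comp_functor (Diag (Diag C)) colim (star (Diag C) colim))
        (comp_functor (Diag (Diag C)) colim (mu C)) mult D) =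
    mult (mu_dgm (Diag C) D) \<cdot> mult (push_dgm (star (Diag C) colim) D)"
proof -
  let ?E = "push_dgm (star (Diag C) colim) D" and ?M = "mu_dgm (Diag C) D" and ?P = "push_dgm (mu C) D"
  have E: "is_dgm (Diag C) ?E" by (rule is_dgm_push[OF is_functor_star[OF is_functor_colim] D])
  have M: "is_dgm (Diag C) ?M" by (rule is_dgm_mu[OF D category_Diag[OF C]])
  have P: "is_dgm (Diag C) ?P" by (rule is_dgm_push[OF is_functor_mu[OF C] D])
  have n: "is_nat (Diag (Diag C)) C (comp_functor (Diag (Diag C)) colim (star (Diag C) colim))
        (comp_functor (Diag (Diag C)) colim (mu C)) mult"
    using is_nat_iso_mult by (simp add: is_nat_iso_def)
  \<comment> \<open>This strict equality makes the target of \<open>mult ?E\<close> the source of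
    \<open>mult ?M\<close>, and turns legs produced by the former into legs consumed by the
    latter.\<close>
  have ME: "mu_dgm C ?E = push_dgm colim ?M" by (rule mu_push_star[OF is_functor_colim D])
  note Ds = is_dgm_DiagD[OF D, unfolded Diag_simps mem_Collect_eq]
  note Es = is_dgm_DiagD[OF Ds(1)]
  have Es': "shape ?E = shape D" "\<And>x. x \<in> obj (shape D) \<Longrightarrow> dob ?E x = push_dgm colim (dob D x)"
    by (simp_all add: push_dgm_simps star_simps Ds)
  have Ps: "shape ?P = shape D" "\<And>x. x \<in> obj (shape D) \<Longrightarrow> dob ?P x = mu_dgm C (dob D x)"
    by (simp_all add: push_dgm_simps mu_def Diag_simps Ds)
  have Ms: "\<And>x y. \<lbrakk>x \<in> obj (shape D); y \<in> obj (shape (dob D x))\<rbrakk> \<Longrightarrow> vpair x y \<in> obj (shape ?M)"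
    "\<And>x y. \<lbrakk>x \<in> obj (shape D); y \<in> obj (shape (dob D x))\<rbrakk> \<Longrightarrow> dob ?M (vpair x y) = dob (dob D x) y"
    by (simp_all add: mu_dgm_simps mu_shape_sel)
  note a = assoc_simps[OF D C]
  let ?N = "nat_star (Diag (Diag C)) (comp_functor (Diag (Diag C)) colim (star (Diag C) colim))
        (comp_functor (Diag (Diag C)) colim (mu C)) mult D"
  have N: "is_dmor C ?N" by (rule is_dmor_nat_star[OF n D])
  have Ns: "msrc ?N = push_dgm colim ?E" "mtgt ?N = push_dgm colim ?P" "mfun ?N = id_functor (shape D)"
    "\<And>x. x \<in> obj (shape D) \<Longrightarrow> mnat ?N x = mult (dob D x)"
    by (simp_all add: nat_star_simps D push_dgm_comp)
  note simps = N Ns D E M P Es' Ps Ms a far_colim k Cs Ds Es mult is_dgm_mu C colim_star_dgm colim_star_simps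
    id_functor_simps mu_k category_assoc[OF C] mu_dgm_simps(1,2) mu_shape_sel
  let ?l = "far colim (assoc C D) \<cdot> mult ?P \<cdot> far colim ?N" and ?r = "mult ?M \<cdot> mult ?E"
  show ?thesis
  proof (rule colim_eqI2[OF E])
    fix x y assume x: "x \<in> obj (shape ?E)" and y: "y \<in> obj (shape (dob ?E x))"
    have x': "x \<in> obj (shape D)" using x by (simp add: Es')
    have y': "y \<in> obj (shape (dob D x))" using y unfolding Es'(2)[OF x'] push_dgm_simps(1) .
    show "?l \<cdot> \<kappa> (push_dgm colim ?E) x \<cdot> \<kappa> (dob ?E x) y = ?r \<cdot> \<kappa> (push_dgm colim ?E) x \<cdot> \<kappa> (dob ?E x) y"
    proof (rule colim_eqI[OF Es(1)[OF x' y']])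
      fix z assume z: "z \<in> obj (shape (dob (dob D x) y))"
      \<comment> \<open>The innermost pair of legs is merged into the leg \<open>(y, z)\<close> of
        \<open>mu_dgm C (dob D x)\<close>, then with the outer one into the leg
        \<open>(x, (y, z))\<close>, which the associator rebrackets.\<close>
      have "?l \<cdot> \<kappa> (push_dgm colim ?E) x \<cdot> \<kappa> (dob ?E x) y \<cdot> \<kappa> (dob (dob D x) y) z =
        \<kappa> (mu_dgm C ?M) (vpair (vpair x y) z)"
        using x' y' z by (simp add: simps)
      \<comment> \<open>Here the outer two legs merge into the leg \<open>(x, y)\<close>, which then
        merges with the leg at \<open>z\<close>.\<close>
      moreover have "?r \<cdot> \<kappa> (push_dgm colim ?E) x \<cdot> \<kappa> (dob ?E x) y \<cdot> \<kappa> (dob (dob D x) y) z =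
        \<kappa> (mu_dgm C ?M) (vpair (vpair x y) z)"
        using x' y' z by (simp add: simps ME)
      ultimately show "(?l \<cdot> \<kappa> (push_dgm colim ?E) x \<cdot> \<kappa> (dob ?E x) y) \<cdot> \<kappa> (dob (dob D x) y) z =
        (?r \<cdot> \<kappa> (push_dgm colim ?E) x \<cdot> \<kappa> (dob ?E x) y) \<cdot> \<kappa> (dob (dob D x) y) z"
        using x' y' z by (simp add: simps ME)
    qed (use x' y' in \<open>simp_all add: simps ME\<close>)
  qed (simp_all add: simps ME)
qed

lemma pseudoalgebra_colim:
  assumes "locally_small TYPE('u) C"
  shows "pseudoalgebra C colim counit mult"
  unfolding pseudoalgebra_def Let_def
proof (intro conjI C assms is_functor_colim is_nat_iso_counit is_nat_iso_mult ext)
  fix D :: "('u, 'o, 'a) dgm"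
  show "whisker_right (Diag C) mult (star C (eta C)) D =
    vcomp (Diag C) C (whisker_left (Diag C) colim (runit C))
      (whisker_left (Diag C) colim (nat_star C (comp_functor C colim (eta C)) (id_functor C) counit)) D"
    \<comment> \<open>Off the diagrams both families are \<open>undefined\<close>, so the law has
      content only for an actual diagram.\<close>
    by (cases "is_dgm C D")
      (simp_all add: whisker_right_def whisker_left_def vcomp_def compose_def Diag_simps star_simps mult_unit)
next
  fix D :: "('u, ('u, ('u, 'o, 'a) dgm, ('u, 'o, 'a) dmor) dgm, ('u, ('u, 'o, 'a) dgm, ('u, 'o, 'a) dmor) dmor) dgm"
  show "vcomp (Diag (Diag (Diag C))) C (whisker_left (Diag (Diag (Diag C))) colim (assoc C))
       (vcomp (Diag (Diag (Diag C))) C (whisker_right (Diag (Diag (Diag C))) mult (star (Diag (Diag C)) (mu C)))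
         (whisker_left (Diag (Diag (Diag C))) colim
           (nat_star (Diag (Diag C)) (comp_functor (Diag (Diag C)) colim (star (Diag C) colim))
             (comp_functor (Diag (Diag C)) colim (mu C)) mult))) D =
       vcomp (Diag (Diag (Diag C))) C (whisker_right (Diag (Diag (Diag C))) mult (mu (Diag C)))
         (whisker_right (Diag (Diag (Diag C))) mult (star (Diag (Diag C)) (star (Diag C) colim))) D"
    by (cases "is_dgm (Diag (Diag C)) D")
      (simp_all add: whisker_right_def whisker_left_def vcomp_def compose_def Diag_simps star_simps mu_def[of "Diag C"] mult_assoc)
qed

end

theorem theorem2p7:
  fixes C :: "('o, 'a) cat"
    and v :: "('u::universe, 'o, 'a) dgm \<Rightarrow> 'o"
    and \<kappa> :: "('u, 'o, 'a) dgm \<Rightarrow> 'u \<Rightarrow> 'a"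
  assumes "cocomplete TYPE('u) C"
    and "colimit_choice C v \<kappa>"
  shows "\<exists>e \<iota> \<gamma>. is_colimit_functor C v \<kappa> e \<and> pseudoalgebra C e \<iota> \<gamma>"
proof -
  interpret chosen_colimits C v \<kappa>
    using assms by unfold_locales (simp_all add: cocomplete_def)
  have "locally_small TYPE('u) C" using assms(1) by (simp add: cocomplete_def)
  then show ?thesis
    using is_colimit_functor_colim pseudoalgebra_colim by blast
qed

end
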